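(* Assume the following conjecture (Lang–Waldschmidt): for integers $b_1,\dots,b_n$ and positive integers $a_1,\dots,a_n$ with $\log a_1,\dots,\log a_n$ linearly independent over $\mathbb{Q}$, setting $B_j=\max\{|b_j|,1\}$ and $B=\max_j B_j$, for every $\epsilon>0$ there is a constant $c(\epsilon)>0$ with $$|b_1\log a_1+\cdots+b_n\log a_n|>\frac{c(\epsilon)^nB}{(B_1\cdots B_na_1\cdots a_n)^{1+\epsilon}}.$$ Let $T$ be large and $y>2$ real. For each $1\leq j\leq \pi(y)$ let $I_j\subset(0,1)$ be an open interval of length $\delta_j>0$ and let $$M=\mathrm{meas}\left\{t\in[T,2T]:\ \left\{\frac{t\log p_j}{2\pi}\right\}\in I_j\text{ for all }1\le j\le\pi(y)\right\}.$$ Then $M\sim T\prod_{j\le\pi(y)}\delta_j$ as $T\to\infty$, uniformly for $y\leq(\log T)/10$ and $\delta_j>(\log T)^{-3/2}$ for all $j$.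
   Context: $p_j$ denotes the $j$-th smallest prime, $\pi(y)$ the number of primes up to $y$, $\{\cdot\}$ the fractional part, and meas the Lebesgue measure. *)

theory Defs
  imports "HOL-Analysis.Analysis" "HOL-Computational_Algebra.Primes"
begin

(* Indexed from 1, as p_1 = 2; Infinite_Set.enumerate starts at 0. *)
definition nth_prime :: "nat \<Rightarrow> nat" where
  "nth_prime j = enumerate {p. prime p} (j - 1)"

definition prime_count :: "real \<Rightarrow> nat" where
  "prime_count y = card {p::nat. prime p \<and> real p \<le> y}"

(* Independence of the family x 1, ..., x n in the rational vector space of real numbers;
   module.independent speaks about sets, so injectivity excludes repeated members. *)
definition rat_lin_independent :: "nat \<Rightarrow> (nat \<Rightarrow> real) \<Rightarrow> bool" where
  "rat_lin_independent n x \<longleftrightarrow>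
     inj_on x {1..n} \<and> module.independent (\<lambda>q r. real_of_rat q * r) (x ` {1..n})"

(* The constant c depends on \<epsilon> alone. The trivial form b = 0 has to be excluded: its left-hand
   side is 0 while the right-hand side is positive. *)
definition Lang_Waldschmidt_conjecture :: bool where
  "Lang_Waldschmidt_conjecture \<longleftrightarrow>
     (\<forall>\<epsilon>::real. \<epsilon> > 0 \<longrightarrow> (\<exists>c::real. c > 0 \<and>
       (\<forall>(n::nat) (b::nat \<Rightarrow> int) (a::nat \<Rightarrow> nat).
          n \<ge> 1 \<longrightarrow> (\<forall>j\<in>{1..n}. a j > 0) \<longrightarrow>
          rat_lin_independent n (\<lambda>j. ln (real (a j))) \<longrightarrow>
          (\<exists>j\<in>{1..n}. b j \<noteq> 0) \<longrightarrow>
          (let B = (\<lambda>j. max \<bar>b j\<bar> 1);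
               Bmax = Max (B ` {1..n})
           in \<bar>\<Sum>j=1..n. of_int (b j) * ln (real (a j))\<bar> >
                c ^ n * of_int Bmax /
                ((\<Prod>j=1..n. of_int (B j)) * (\<Prod>j=1..n. real (a j))) powr (1 + \<epsilon>)))))"

definition open_interval_of_length :: "real \<Rightarrow> real set \<Rightarrow> bool" where
  "open_interval_of_length d I \<longleftrightarrow> (\<exists>u. I = {u<..<u + d})"

definition Kronecker_measure :: "real \<Rightarrow> real \<Rightarrow> (nat \<Rightarrow> real set) \<Rightarrow> real" where
  "Kronecker_measure T y I =
     measure lebesgue {t \<in> {T..2 * T}. \<forall>j\<in>{1..prime_count y}.
        frac (t * ln (real (nth_prime j)) / (2 * pi)) \<in> I j}"

end

(* Write L = ln T, h = L^(-5/2) and K ~ L^5. Each indicator of I_j is squeezed between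
   trigonometric polynomials of degree K with means delta_j - 2h and delta_j + 2h, obtained by
   truncating the Fourier series of trapezoids. Minorants that may be negative cannot be multiplied,
   so the lower bound uses
     prod F_j - prod 1_j <= sum_i (F_i - 1_i) prod_{j /= i} F_j
   for majorants F_j, with the minorant of I_i inserted for 1_i. After expanding, only the zero
   frequency gives a main term; every other frequency is an integer combination of logarithms of
   primes, which the conjecture bounds from below by a product over j, so the total error is a
   product as well. With prod_{p <= y} p <= 4^y and the resulting Chebyshev bound
   pi(y) ln L <= 0.15 L, the relative error is at most exp(-0.16 L) up to a factor O(L).
   The factor h / delta_j <= 1/L gives the remaining errors, as pi(y) / L tends to 0. *)
theory Submission
  imports Defs "HOL-Real_Asymp.Real_Asymp"
begin

section \<open>The Fourier series of the quadratic Bernoulli polynomial\<close>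

text \<open>The intervals may be so short that the main term is close to T * L^(-3N/2) with N =
  \<open>prime_count y\<close>, so errors are counted in powers of L per prime: as N * ln L <= 0.15
  L, a factor L^k per prime costs at most T^(0.15 k). This fixes the parameters. Smoothing at scale
  h changes the main term by a relative amount of order N * h / min \<delta>_j; N is only known to
  be O(L / ln L), and h = L^(-5/2) leaves O(1 / ln L). Truncating at degree K costs 1 / (h K), which
  K >= h^(-2) brings below h. Coefficients of size 1 / (h b^2) against the weight |b|^(1 +
  \<epsilon>) of the conjecture sum to about K^\<epsilon> * ln K / h, so that for small \<epsilon>
  the price per prime is set by h and hardly by K; \<epsilon> = 1/25 keeps it below L^3. The
  trapezoids come from the Bernoulli polynomial of degree 2: its difference quotient with step h is
  a sawtooth with a ramp in place of the jump, and two translates of that sawtooth differ by a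
  trapezoid up to a constant. One absolutely convergent Fourier series therefore serves all
  intervals.\<close>

lemma cos_odd_pi_half: "cos (real (2 * n + 1) * pi * (1 / 2)) = 0"
proof -
  have *: "real (2 * n + 1) * pi * (1 / 2) = real n * pi + pi / 2"
    by (simp add: field_simps)
  show ?thesis unfolding * by (simp add: cos_add)
qed

lemma dirichlet_kernel:
  "(1 + 2 * (\<Sum>b=1..n. cos (2 * pi * real b * x))) * sin (pi * x) = sin (real (2 * n + 1) * pi * x)"
proof (induction n)
  case (Suc n)
  have "2 * cos (2 * pi * real (Suc n) * x) * sin (pi * x)
      = sin (2 * pi * real (Suc n) * x + pi * x) - sin (2 * pi * real (Suc n) * x - pi * x)"
    by (simp add: sin_add sin_diff)
  moreover have "2 * pi * real (Suc n) * x + pi * x = real (2 * Suc n + 1) * pi * x"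
    and "2 * pi * real (Suc n) * x - pi * x = real (2 * n + 1) * pi * x"
    by (simp_all add: algebra_simps)
  ultimately have "2 * cos (2 * pi * real (Suc n) * x) * sin (pi * x)
      = sin (real (2 * Suc n + 1) * pi * x) - sin (real (2 * n + 1) * pi * x)"
    by simp
  with Suc show ?case by (simp add: algebra_simps)
qed simp

text \<open>Partial sums of the Fourier series of half the periodic Bernoulli polynomial x^2 - x +
  1/6. The normalisation gives the second derivative -2 times a sum of cosines, which matches the
  Dirichlet kernel.\<close>

definition cos_sum :: "nat \<Rightarrow> real \<Rightarrow> real" where
  "cos_sum n x = (\<Sum>b=1..n. cos (2 * pi * real b * x) / (2 * pi ^ 2 * real b ^ 2))"

lemma mvt_bound:
  fixes f f' :: "real \<Rightarrow> real"
  assumes d: "\<And>s. s \<in> {r..1-r} \<Longrightarrow> (f has_real_derivative f' s) (at s)"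
    and b: "\<And>s. s \<in> {r..1-r} \<Longrightarrow> \<bar>f' s\<bar> \<le> B" and "0 < r" and x: "x \<in> {r..1-r}"
  shows "\<bar>f x - f (1/2)\<bar> \<le> B"
proof -
  have h: "1/2 \<in> {r..1-r}" using x by auto
  have "norm (f x - f (1/2)) \<le> B * norm (x - 1/2)"
    by (rule field_differentiable_bound[of "{r..1-r}" f f'])
       (use d b x h in \<open>auto intro: has_field_derivative_at_within\<close>)
  also have "\<dots> \<le> B * 1"
    using b[OF h] x \<open>0 < r\<close> by (intro mult_left_mono) auto
  finally show ?thesis by simp
qed

text \<open>The deviation from the quadratic has the Dirichlet kernel as second derivative, up to sign;
  removing the oscillating primitive of that kernel leaves a function \<open>H\<close> with derivative
  \<open>O(1 / n)\<close> that vanishes at \<open>1/2\<close>.\<close>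

lemma cos_sum_deviation:
  assumes "0 < r" "x \<in> {r..1-r}"
  shows "\<bar>(cos_sum n x - (x\<^sup>2 - x) / 2) - (cos_sum n (1/2) - ((1/2)\<^sup>2 - 1/2) / 2)\<bar>
      \<le> 2 / (real (2 * n + 1) * sin (pi * r) ^ 2)"
proof -
  define m where "m = real (2 * n + 1)"
  define \<sigma> where "\<sigma> = sin (pi * r)"
  define R' where "R' x = - (\<Sum>b=1..n. sin (2 * pi * real b * x) / (pi * real b)) - (x - 1/2)" for x
  define H where "H x = R' x - cos (m * pi * x) / (m * pi * sin (pi * x))" for x
  have m: "m \<ge> 1" by (simp add: m_def)
  have r: "r \<le> 1/2" using assms by auto
  have \<sigma>: "0 < \<sigma>" "\<sigma> \<le> 1"
    using assms r by (auto simp: \<sigma>_def intro!: sin_gt_zero)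
  have pir: "- (pi / 2) \<le> pi * r"
  proof -
    have "0 \<le> pi * r" using assms by simp
    then show ?thesis using pi_gt_zero by linarith
  qed
  have sin_ge: "sin (pi * s) \<ge> \<sigma>" if "s \<in> {r..1-r}" for s
  proof -
    have half: "\<sigma> \<le> sin (pi * z)" if "r \<le> z" "z \<le> 1/2" for z
    proof -
      have "pi * r \<le> pi * z" "pi * z \<le> pi * (1/2)"
        using that by (intro mult_left_mono; simp)+
      then show ?thesis
        unfolding \<sigma>_def using pir by (intro sin_monotone_2pi_le) auto
    qed
    have "sin (pi * (1 - s)) = sin (pi * s)"
      by (simp add: right_diff_distrib)
    then show ?thesis
      using half[of s] half[of "1 - s"] that by (cases "s \<le> 1/2") auto
  qed
  have H': "(H has_real_derivative
      cos (m * pi * s) * cos (pi * s) / (m * sin (pi * s) ^ 2)) (at s)"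
    if s: "s \<in> {r..1-r}" for s
  proof -
    have nz: "sin (pi * s) \<noteq> 0" using sin_ge[OF s] \<sigma> by auto
    have "(R' has_real_derivative - (\<Sum>b=1..n. 2 * cos (2 * pi * real b * s)) - 1) (at s)"
      unfolding R'_def
      by (auto intro!: derivative_eq_intros sum.cong)
    moreover have "sin (m * pi * s) / sin (pi * s) = 1 + (\<Sum>b=1..n. 2 * cos (2 * pi * real b * s))"
      unfolding m_def dirichlet_kernel[symmetric] sum_distrib_left[symmetric] using nz by simp
    then have "- (\<Sum>b=1..n. 2 * cos (2 * pi * real b * s)) - 1 = - (sin (m * pi * s) / sin (pi * s))"
      by linarith
    ultimately have 1: "(R' has_real_derivative - (sin (m * pi * s) / sin (pi * s))) (at s)"
      by simp
    have 2: "((\<lambda>x. cos (m * pi * x) / (m * pi * sin (pi * x))) has_real_derivative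
      - (sin (m * pi * s) / sin (pi * s)) - cos (m * pi * s) * cos (pi * s) / (m * sin (pi * s) ^ 2)) (at s)"
      using m nz by (auto intro!: derivative_eq_intros simp: field_simps power2_eq_square)
    show ?thesis unfolding H_def
      using DERIV_diff[OF 1 2] by simp
  qed
  \<comment> \<open>The base point is 1/2 because \<open>m\<close> is odd and every sin (pi b) is 0,
    so both parts of \<open>H\<close> vanish there.\<close>
  have "cos (m * pi * (1/2)) = 0"
    using cos_odd_pi_half[of n] by (simp add: m_def)
  moreover have "sin (2 * pi * real b * (1/2)) = 0" for b
    by (simp add: mult.commute[of pi])
  ultimately have H0: "H (1/2) = 0"
    by (simp add: H_def R'_def)
  have Hb: "\<bar>H s\<bar> \<le> 1 / (m * \<sigma>\<^sup>2)" if s: "s \<in> {r..1-r}" for s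
  proof -
    have "\<bar>H s - H (1/2)\<bar> \<le> 1 / (m * \<sigma>\<^sup>2)"
    proof (rule mvt_bound[OF H' _ assms(1) s])
      fix s assume s: "s \<in> {r..1-r}"
      have "\<bar>cos (m * pi * s) * cos (pi * s)\<bar> \<le> 1 * 1"
        unfolding abs_mult by (intro mult_mono) auto
      moreover have "m * \<sigma>\<^sup>2 \<le> m * sin (pi * s) ^ 2"
        using sin_ge[OF s] \<sigma> m by (intro mult_left_mono power_mono) auto
      ultimately show "\<bar>cos (m * pi * s) * cos (pi * s) / (m * (sin (pi * s))\<^sup>2)\<bar> \<le> 1 / (m * \<sigma>\<^sup>2)"
        using m \<sigma> unfolding abs_divide by (intro frac_le) auto
    qed auto
    then show ?thesis by (simp add: H0)
  qed
  have R'b: "\<bar>R' s\<bar> \<le> 2 / (m * \<sigma>\<^sup>2)" if s: "s \<in> {r..1-r}" for s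
  proof -
    have "m * \<sigma>\<^sup>2 \<le> m * pi * sin (pi * s)"
    proof -
      have "\<sigma>\<^sup>2 \<le> 1 * \<sigma>" unfolding power2_eq_square using \<sigma> by (intro mult_right_mono) auto
      also have "\<dots> \<le> pi * sin (pi * s)"
        using sin_ge[OF s] \<sigma> pi_ge_two by (intro mult_mono) auto
      finally show ?thesis using m by (simp add: mult.assoc)
    qed
    moreover have "0 \<le> m * pi * sin (pi * s)" using m sin_ge[OF s] \<sigma> by simp
    ultimately have "m * \<sigma>\<^sup>2 \<le> \<bar>m * pi * sin (pi * s)\<bar>" by simp
    then have "\<bar>cos (m * pi * s) / (m * pi * sin (pi * s))\<bar> \<le> 1 / (m * \<sigma>\<^sup>2)"
      using m \<sigma> unfolding abs_divide by (intro frac_le) auto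
    moreover have "R' s = H s + cos (m * pi * s) / (m * pi * sin (pi * s))"
      by (simp add: H_def)
    then have "\<bar>R' s\<bar> \<le> \<bar>H s\<bar> + \<bar>cos (m * pi * s) / (m * pi * sin (pi * s))\<bar>"
      by (simp only: abs_triangle_ineq)
    ultimately have "\<bar>R' s\<bar> \<le> 1 / (m * \<sigma>\<^sup>2) + 1 / (m * \<sigma>\<^sup>2)"
      using Hb[OF s] by argo
    then show ?thesis by simp
  qed
  show ?thesis
    unfolding m_def[symmetric] \<sigma>_def[symmetric]
  proof (rule mvt_bound[where f = "\<lambda>x. cos_sum n x - (x\<^sup>2 - x) / 2", OF _ R'b assms])
    fix s
    have "((\<lambda>x. cos (2 * pi * real b * x) / (2 * pi\<^sup>2 * (real b)\<^sup>2)) has_real_derivative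
        - (sin (2 * pi * real b * s) / (pi * real b))) (at s)" if "b \<in> {1..n}" for b
      using that by (auto intro!: derivative_eq_intros simp: power2_eq_square)
    then have "(cos_sum n has_real_derivative - (\<Sum>b=1..n. sin (2 * pi * real b * s) / (pi * real b))) (at s)"
      unfolding cos_sum_def[abs_def] sum_negf[symmetric] by (intro DERIV_sum)
    moreover have "((\<lambda>x. (x\<^sup>2 - x) / 2) has_real_derivative s - 1/2) (at s)"
      by (auto intro!: derivative_eq_intros)
    ultimately show "((\<lambda>x. cos_sum n x - (x\<^sup>2 - x) / 2) has_real_derivative R' s) (at s)"
      unfolding R'_def by (rule DERIV_diff)
  qed auto
qed

section \<open>Convergence of the cosine series and its truncation error\<close>

lemma inverse_squares_tail_le:
  assumes "0 < K" "K \<le> n"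
  shows "(\<Sum>b=Suc K..n. 1 / real b ^ 2) \<le> 1 / real K"
proof -
  have "(\<Sum>b=Suc K..n. 1 / real b ^ 2) \<le> 1 / real K - 1 / real n"
    using assms(2)
  proof (induction n rule: dec_induct)
    case (step n)
    have "1 / real (Suc n) ^ 2 \<le> 1 / real n - 1 / real (Suc n)"
    proof -
      have n: "real n > 0" using step(1) assms(1) by simp
      then have "1 / real n - 1 / real (Suc n) = 1 / (real n * real (Suc n))"
        by (simp add: field_simps)
      moreover have "1 / real (Suc n) ^ 2 \<le> 1 / (real n * real (Suc n))"
        unfolding power2_eq_square using n by (intro frac_le mult_right_mono) auto
      ultimately show ?thesis by simp
    qed
    then show ?case using step by (simp add: sum.nat_ivl_Suc')
  qed simp
  then show ?thesis using divide_nonneg_nonneg[of 1 "real n"] by linarith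
qed

lemma cos_sum_diff_le:
  assumes "0 < K" "K \<le> n"
  shows "\<bar>cos_sum n x - cos_sum K x\<bar> \<le> 1 / (2 * pi ^ 2 * real K)"
proof -
  have "cos_sum n x - cos_sum K x = (\<Sum>b=Suc K..n. cos (2 * pi * real b * x) / (2 * pi ^ 2 * real b ^ 2))"
    unfolding cos_sum_def
    using sum.ub_add_nat[of 1 K "\<lambda>b. cos (2 * pi * real b * x) / (2 * pi ^ 2 * real b ^ 2)" "n - K"] assms
    by simp
  also have "\<bar>\<dots>\<bar> \<le> (\<Sum>b=Suc K..n. 1 / (2 * pi ^ 2) * (1 / real b ^ 2))"
    by (rule order.trans[OF sum_abs sum_mono]) (auto simp: abs_mult intro!: divide_right_mono)
  also have "\<dots> \<le> 1 / (2 * pi ^ 2) * (1 / real K)"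
    unfolding sum_distrib_left[symmetric]
    by (intro mult_left_mono inverse_squares_tail_le assms) auto
  finally show ?thesis by simp
qed

lemma cos_sum_frac: "cos_sum n (frac x) = cos_sum n x"
  unfolding cos_sum_def
proof (intro sum.cong refl arg_cong2[where f = "(/)"])
  fix b
  have "2 * pi * real b * frac x = 2 * pi * real b * x + 2 * pi * of_int (- (int b * floor x))"
    by (simp add: frac_def algebra_simps)
  then show "cos (2 * pi * real b * frac x) = cos (2 * pi * real b * x)"
    by (metis cos_int_2pin mult.commute cos_add mult_1_right sin_int_2pin mult_zero_right diff_zero)
qed

text \<open>Letting n tend to infinity in \<open>cos_sum_deviation\<close> makes the limit differ
  from the quadratic by a constant on the open unit interval. The Weierstrass test makes the limit
  continuous, which carries the identity to the endpoints, and periodicity carries it to all x. The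
  constant stays abstract because later only combinations occur in which it cancels.\<close>

lemma cos_sum_limit:
  obtains C where "\<And>x. (\<lambda>n. cos_sum n x) \<longlonglongrightarrow> ((frac x)\<^sup>2 - frac x) / 2 + C"
proof -
  define g where "g x = (\<Sum>b. cos (2 * pi * real (Suc b) * x) / (2 * pi ^ 2 * real (Suc b) ^ 2))" for x
  have cs: "cos_sum n x = (\<Sum>b<n. cos (2 * pi * real (Suc b) * x) / (2 * pi ^ 2 * real (Suc b) ^ 2))" for n x
    unfolding cos_sum_def by (simp only: sum.atLeast1_atMost_eq One_nat_def)
  have sm: "summable (\<lambda>b. 1 / real (Suc b) ^ 2)"
    using inverse_squares_sums by (simp add: sums_iff add_ac)
  have ul: "uniform_limit UNIV cos_sum g sequentially"
    unfolding cs[abs_def] g_def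
  proof (rule Weierstrass_m_test[OF _ sm])
    fix b x
    have "1 * real (Suc b) ^ 2 \<le> 2 * pi\<^sup>2 * real (Suc b) ^ 2"
    proof (rule mult_right_mono)
      have "1 \<le> pi\<^sup>2" using pi_ge_two by (intro one_le_power) linarith
      then show "1 \<le> 2 * pi\<^sup>2" by linarith
    qed auto
    then show "norm (cos (2 * pi * real (Suc b) * x) / (2 * pi\<^sup>2 * (real (Suc b))\<^sup>2)) \<le> 1 / (real (Suc b))\<^sup>2"
      unfolding norm_divide by (intro frac_le) auto
  qed
  have lim: "(\<lambda>n. cos_sum n x) \<longlonglongrightarrow> g x" for x
    using tendsto_uniform_limitI[OF ul, of x] by simp
  have contg: "continuous_on UNIV g"
    by (rule uniform_limit_theorem[OF _ ul])
       (auto simp: cos_sum_def[abs_def] intro!: continuous_intros always_eventually)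
  define R where "R x = g x - (x\<^sup>2 - x) / 2" for x
  have in01: "R x = R (1/2)" if x: "x \<in> {0<..<1}" for x
  proof -
    define r where "r = min x (1 - x)"
    have r: "0 < r" "x \<in> {r..1-r}" using x by (auto simp: r_def)
    have "sin (pi * r) > 0"
      using r by (intro sin_gt_zero) (auto)
    then have L: "(\<lambda>n. 2 / (real (2 * n + 1) * sin (pi * r) ^ 2)) \<longlonglongrightarrow> 0"
      by real_asymp
    have "(\<lambda>n. \<bar>(cos_sum n x - (x\<^sup>2 - x) / 2) - (cos_sum n (1/2) - ((1/2)\<^sup>2 - 1/2) / 2)\<bar>)
       \<longlonglongrightarrow> \<bar>R x - R (1/2)\<bar>"
      unfolding R_def by (intro tendsto_intros lim)
    then have "\<bar>R x - R (1/2)\<bar> \<le> 0"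
      by (rule LIMSEQ_le[OF _ L]) (use cos_sum_deviation[OF r] in auto)
    then show ?thesis by simp
  qed
  have "R x = R (1/2)" if x: "x \<in> closure {0<..<1}" for x
    by (rule continuous_constant_on_closure[OF _ in01 x])
       (auto simp: R_def intro!: continuous_intros continuous_on_subset[OF contg])
  then have "g (frac x) = ((frac x)\<^sup>2 - frac x) / 2 + R (1/2)" for x
    using frac_lt_1[of x] by (simp add: R_def less_imp_le frac_ge_0 algebra_simps)
  moreover have "g (frac x) = g x" for x
    using LIMSEQ_unique[OF lim[of "frac x"]] lim[of x] by (simp add: cos_sum_frac)
  ultimately show ?thesis using lim that[of "R (1/2)"] by simp
qed

lemma cos_sum_approx:
  obtains C where
    "\<And>K x. 0 < K \<Longrightarrow> \<bar>((frac x)\<^sup>2 - frac x) / 2 + C - cos_sum K x\<bar> \<le> 1 / (2 * pi ^ 2 * real K)"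
proof -
  obtain C where C: "\<And>x. (\<lambda>n. cos_sum n x) \<longlonglongrightarrow> ((frac x)\<^sup>2 - frac x) / 2 + C"
    using cos_sum_limit by blast
  show ?thesis
  proof (rule that[of C])
    fix K :: nat and x assume "0 < K"
    have "(\<lambda>n. \<bar>cos_sum n x - cos_sum K x\<bar>) \<longlonglongrightarrow> \<bar>((frac x)\<^sup>2 - frac x) / 2 + C - cos_sum K x\<bar>"
      by (intro tendsto_intros C)
    then show "\<bar>((frac x)\<^sup>2 - frac x) / 2 + C - cos_sum K x\<bar> \<le> 1 / (2 * pi ^ 2 * real K)"
      by (rule LIMSEQ_le_const2) (use cos_sum_diff_le[OF \<open>0 < K\<close>] in blast)
  qed
qed

section \<open>Trigonometric majorants and minorants of intervals\<close>

text \<open>The sawtooth frac x - 1/2 with its jump at the integers replaced by a ramp over the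
  first stretch of length \<open>h\<close> of each period. The ramp has mean h/2, and the term - h/2
  restores mean zero.\<close>

definition smooth_sawtooth :: "real \<Rightarrow> real \<Rightarrow> real" where
  "smooth_sawtooth h x = frac x - 1/2 - h/2 + max 0 (1 - frac x / h)"

text \<open>Both sides are the average of frac t - 1/2 over the window from x - h to x, since ((frac
  t)^2 - frac t) / 2 is a continuous primitive. The cases separate windows that stay inside one
  period from windows that cross an integer.\<close>

lemma smooth_sawtooth_eq_diff_quotient:
  assumes h: "0 < h" "h < 1"
  shows "smooth_sawtooth h x
    = (((frac x)\<^sup>2 - frac x) / 2 - ((frac (x - h))\<^sup>2 - frac (x - h)) / 2) / h"
proof (cases "h \<le> frac x")
  case True
  have *: "frac (x - h) = frac x - h"
    unfolding frac_unique_iff using True h frac_lt_1[of x] by (auto simp: frac_def)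
  have "max 0 (1 - frac x / h) = 0" using True h by (simp add: field_simps)
  then show ?thesis
    using h unfolding smooth_sawtooth_def * by (simp add: field_simps power2_eq_square)
next
  case False
  have "x - h - (frac x - h + 1) = of_int (floor x - 1)"
    by (simp add: frac_def)
  then have *: "frac (x - h) = frac x - h + 1"
    unfolding frac_unique_iff using False h frac_ge_0[of x] by (simp only: Ints_of_int, intro conjI TrueI; linarith)
  have "max 0 (1 - frac x / h) = 1 - frac x / h" using False h by (simp add: field_simps)
  then show ?thesis
    using h unfolding smooth_sawtooth_def * by (simp add: field_simps power2_eq_square)
qed

text \<open>With the sharp sawtooth the same formula gives, for 0 < d < 1, the 1-periodic indicator
  of the interval from a to a + d. Here it rises from \<open>a\<close> to a + h and falls from a + d
  to a + d + h when these ramps do not overlap modulo 1; its mean is \<open>d\<close>.\<close>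

definition trapezoid :: "real \<Rightarrow> real \<Rightarrow> real \<Rightarrow> real \<Rightarrow> real" where
  "trapezoid h a d x = d + smooth_sawtooth h (x - a - d) - smooth_sawtooth h (x - a)"

definition trig_poly :: "nat \<Rightarrow> (int \<Rightarrow> complex) \<Rightarrow> real \<Rightarrow> complex" where
  "trig_poly K C x = (\<Sum>b\<in>{- int K..int K}. C b * cis (2 * pi * of_int b * x))"

lemma sum_symmetric_int_interval:
  fixes f :: "int \<Rightarrow> 'a::ab_group_add"
  shows "(\<Sum>b\<in>{- int K..int K}. f b) = f 0 + (\<Sum>b=1..K. f (int b) + f (- int b))"
proof (induction K)
  case (Suc K)
  have "{- int (Suc K)..int (Suc K)} = insert (int (Suc K)) (insert (- int (Suc K)) {- int K..int K})"
    by auto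
  then show ?case using Suc by (simp add: algebra_simps)
qed simp

text \<open>Splitting each cosine into two conjugate exponentials and exchanging the sums; the terms
  for b and - b stay paired so that the result fits
  \<open>sum_symmetric_int_interval\<close>.\<close>

lemma cos_sum_combination:
  "complex_of_real (\<Sum>i\<in>A. s i * cos_sum K (x - z i)) =
     (\<Sum>b=1..K. (\<Sum>i\<in>A. of_real (s i) * cis (- 2 * pi * real b * z i)) / of_real (4 * (pi ^ 2 * real b ^ 2))
           * cis (2 * pi * real b * x)
       + (\<Sum>i\<in>A. of_real (s i) * cis (2 * pi * real b * z i)) / of_real (4 * (pi ^ 2 * real b ^ 2))
           * cis (- 2 * pi * real b * x))"
    (is "_ = (\<Sum>b=1..K. ?rhs b)")
proof -
  have alg: "of_real r * ((p * q + p' * q') / 2 / of_real (2 * c))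
      = of_real r * p / of_real (4 * c) * q + of_real r * p' / of_real (4 * c) * q'"
    for r c :: real and p p' q q' :: complex
    by (cases "c = 0") (simp_all add: field_simps)
  have half: "complex_of_real (cos t) = (cis t + cis (- t)) / 2" for t
    by (simp add: complex_eq_iff)
  have cos_eq: "complex_of_real (cos (2 * pi * real b * (x - z))) =
     (cis (- 2 * pi * real b * z) * cis (2 * pi * real b * x)
      + cis (2 * pi * real b * z) * cis (- 2 * pi * real b * x)) / 2" for b z
    unfolding half cis_mult by (simp add: algebra_simps)
  have "complex_of_real (\<Sum>i\<in>A. s i * cos_sum K (x - z i)) =
    (\<Sum>i\<in>A. \<Sum>b=1..K. of_real (s i) * (of_real (cos (2 * pi * real b * (x - z i))) / of_real (2 * (pi ^ 2 * real b ^ 2))))"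
    unfolding cos_sum_def sum_distrib_left of_real_sum of_real_mult of_real_divide
    by (simp add: mult.assoc)
  also have "\<dots> = (\<Sum>b=1..K. \<Sum>i\<in>A. of_real (s i) * (of_real (cos (2 * pi * real b * (x - z i))) / of_real (2 * (pi ^ 2 * real b ^ 2))))"
    by (rule sum.swap)
  also have "\<dots> = (\<Sum>b=1..K. ?rhs b)"
    unfolding cos_eq alg sum_divide_distrib sum_distrib_right sum.distrib[symmetric] ..
  finally show ?thesis .
qed

text \<open>By the difference quotient formula a trapezoid is \<open>d\<close> plus four translates
  of the quadratic with factors 1/h or - 1/h; each translate is replaced by its cosine sum. The
  factors add up to zero, so the unknown constant \<open>G0\<close> drops out. The four coefficient
  bounds add up to 1 / (h pi^2 b^2), the four truncation errors to 2 / (h pi^2 K).\<close>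

lemma trapezoid_approx:
  assumes h: "0 < h" "h < 1" and K: "0 < K"
  obtains C where "C 0 = complex_of_real d" "\<forall>b. b \<noteq> 0 \<longrightarrow> norm (C b) \<le> 1 / (h * of_int b ^ 2)"
    "\<forall>x. trig_poly K C x \<in> \<real>" "\<forall>x. \<bar>Re (trig_poly K C x) - trapezoid h a d x\<bar> \<le> 1 / (h * real K)"
proof -
  obtain G0 where G0: "\<And>K x. 0 < K \<Longrightarrow> \<bar>((frac x)\<^sup>2 - frac x) / 2 + G0 - cos_sum K x\<bar> \<le> 1 / (2 * pi ^ 2 * real K)"
    using cos_sum_approx by blast
  define s where "s i = (if i \<in> {0, 3} then 1 / h else - 1 / h)" for i :: nat
  define z where "z i = (if i = 0 then a + d else if i = 1 then a + d + h else if i = 2 then a else a + h)" for i :: nat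
  define A where "A = {0::nat, 1, 2, 3}"
  define C where "C b = (if b = 0 then complex_of_real d
     else (\<Sum>i\<in>A. of_real (s i) * cis (- 2 * pi * of_int b * z i)) / of_real (4 * (pi ^ 2 * of_int b ^ 2)))" for b :: int
  have trig: "trig_poly K C x = complex_of_real (d + (\<Sum>i\<in>A. s i * cos_sum K (x - z i)))" for x
    unfolding of_real_add cos_sum_combination trig_poly_def sum_symmetric_int_interval
    by (intro arg_cong2[where f = "(+)"] sum.cong) (auto simp: C_def)
  have pi2: "pi ^ 2 \<ge> 4"
    using power_mono[OF pi_ge_two, of 2] by simp
  show ?thesis
  proof (rule that[of C])
    show "C 0 = d" by (simp add: C_def)
    have "norm (C b) \<le> 1 / (h * of_int b ^ 2)" if b: "b \<noteq> 0" for b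
    proof -
      have "norm (\<Sum>i\<in>A. s i * cis (- 2 * pi * of_int b * z i)) \<le> (\<Sum>i\<in>A. 1 / h)"
        by (rule sum_norm_le) (use h in \<open>auto simp: norm_mult s_def\<close>)
      also have "\<dots> = 4 / h" by (simp add: A_def)
      finally have "norm (\<Sum>i\<in>A. s i * cis (- 2 * pi * of_int b * z i)) / (4 * (pi ^ 2 * of_int b ^ 2))
          \<le> 4 / h / (4 * (pi ^ 2 * of_int b ^ 2))"
        by (rule divide_right_mono) simp
      then have "norm (C b) \<le> 4 / h / (4 * (pi ^ 2 * of_int b ^ 2))"
        using b by (simp add: C_def norm_divide norm_mult norm_power)
      also have "\<dots> = 1 / (h * (pi ^ 2 * of_int b ^ 2))" by simp
      also have "\<dots> \<le> 1 / (h * (1 * of_int b ^ 2))"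
        using b h pi2 by (intro divide_left_mono mult_left_mono mult_right_mono) auto
      finally show ?thesis by simp
    qed
    then show "\<forall>b. b \<noteq> 0 \<longrightarrow> norm (C b) \<le> 1 / (h * of_int b ^ 2)" by blast
    show "\<forall>x. trig_poly K C x \<in> \<real>" unfolding trig by simp
    have "\<bar>Re (trig_poly K C x) - trapezoid h a d x\<bar> \<le> 1 / (h * real K)" for x
    proof -
      define E where "E i = cos_sum K (x - z i) - (((frac (x - z i))\<^sup>2 - frac (x - z i)) / 2 + G0)" for i
      have "\<bar>E i\<bar> \<le> 1 / (2 * pi ^ 2 * real K)" for i
        unfolding E_def using G0[OF K, of "x - z i"] by (simp add: abs_minus_commute)
      moreover have "Re (trig_poly K C x) - trapezoid h a d x = (\<Sum>i\<in>A. s i * E i)"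
        unfolding trig trapezoid_def smooth_sawtooth_eq_diff_quotient[OF h]
        using h by (simp add: A_def s_def z_def E_def field_simps)
      ultimately have "\<bar>Re (trig_poly K C x) - trapezoid h a d x\<bar> \<le> (\<Sum>i\<in>A. 1 / h * (1 / (2 * pi ^ 2 * real K)))"
        by (simp only:, intro order.trans[OF sum_abs sum_mono], unfold abs_mult, intro mult_mono)
           (use h in \<open>auto simp: s_def\<close>)
      also have "\<dots> = 2 / (h * (pi ^ 2 * real K))" by (simp add: A_def)
      also have "\<dots> \<le> 2 / (h * (2 * real K))"
        using K h pi2 by (intro divide_left_mono mult_left_mono mult_right_mono) auto
      finally show ?thesis by simp
    qed
    then show "\<forall>x. \<bar>Re (trig_poly K C x) - trapezoid h a d x\<bar> \<le> 1 / (h * real K)" by blast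
  qed
qed

section \<open>Pointwise comparison of trapezoids with indicators\<close>

lemma trapezoid_eq:
  assumes v: "v = x - a + of_int m" "0 \<le> v" "v < 1"
    and w: "w = v - d + of_int k" "0 \<le> w" "w < 1"
  shows "trapezoid h a d x = of_int k + max 0 (1 - w / h) - max 0 (1 - v / h)"
proof -
  have "frac (x - a) = v"
    unfolding frac_unique_iff using v by (auto simp: Ints_def intro: image_eqI[of _ _ "- m"])
  moreover have "frac (x - a - d) = w"
    unfolding frac_unique_iff using v w by (auto simp: Ints_def intro: image_eqI[of _ _ "- m - k"])
  ultimately show ?thesis by (simp add: trapezoid_def smooth_sawtooth_def w)
qed

text \<open>Here \<open>v\<close> and \<open>w\<close> are the residues of x - a and x - a - d. The
  integer k = d + w - v is what the sharp sawtooth would give, and the two maxima are the ramps, so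
  each bound below is a case distinction on \<open>k\<close>.\<close>

lemma trapezoid_cases:
  assumes "0 < h"
  obtains m k v w where "v = x - a + of_int m" "0 \<le> v" "v < 1" "w = v - d + of_int k" "0 \<le> w" "w < 1"
    "trapezoid h a d x = of_int k + max 0 (1 - w / h) - max 0 (1 - v / h)"
proof -
  define v where "v = x - a + of_int (- floor (x - a))"
  define w where "w = v - d + of_int (- floor (v - d))"
  have "0 \<le> v" "v < 1" "0 \<le> w" "w < 1"
    unfolding w_def v_def by (simp_all) linarith+
  then show ?thesis
    using that[OF v_def _ _ w_def] trapezoid_eq[OF v_def _ _ w_def] by blast
qed

lemma trapezoid_nonneg:
  assumes h: "0 < h" and d: "0 \<le> d"
  shows "0 \<le> trapezoid h a d x"
proof -
  obtain m k v w where *: "v = x - a + of_int m" "0 \<le> v" "v < 1" "w = v - d + of_int k" "0 \<le> w" "w < 1"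
    "trapezoid h a d x = of_int k + max 0 (1 - w / h) - max 0 (1 - v / h)"
    by (rule trapezoid_cases[OF h, of x a d])
  have v: "max 0 (1 - v / h) \<le> 1" using * h by simp
  have "real_of_int k > - 1" using * d by linarith
  then consider "k = 0" | "k \<ge> 1" by linarith
  then show ?thesis
  proof cases
    case 1
    then have "w / h \<le> v / h" using * d h by (intro divide_right_mono) auto
    then show ?thesis using * 1 by simp
  qed (use * v in simp)
qed

lemma trapezoid_ge_1:
  assumes h: "0 < h" and d: "0 \<le> d" and x: "frac x \<in> {a + h<..<a + d}"
  shows "1 \<le> trapezoid h a d x"
proof -
  obtain m k v w where *: "v = x - a + of_int m" "0 \<le> v" "v < 1" "w = v - d + of_int k" "0 \<le> w" "w < 1"
    "trapezoid h a d x = of_int k + max 0 (1 - w / h) - max 0 (1 - v / h)"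
    by (rule trapezoid_cases[OF h, of x a d])
  \<comment> \<open>The majorant uses a = u - h and length \<delta> + h, so \<open>a\<close> may be
    negative and the length may exceed 1. A wrap \<open>j\<close> <= -1 pushes v - d below -1, which
    makes \<open>k\<close> at least 2 and outweighs the ramp of \<open>v\<close>.\<close>
  define j where "j = m + floor x"
  have vj: "v = frac x - a + of_int j" by (simp add: * j_def frac_def)
  have "real_of_int j < 1" using vj * x h by auto
  then consider "j = 0" | "j \<le> -1" by linarith
  then show ?thesis
  proof cases
    case 1
    then have "real_of_int k > 0" using * vj x by auto
    moreover have "max 0 (1 - v / h) = 0" using 1 vj x h by (simp add: field_simps)
    ultimately show ?thesis using * by simp
  next
    case 2
    then have "v - d \<le> frac x - a - 1 - d" using vj by simp
    then have "real_of_int k > 1" using * x by auto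
    moreover have v: "max 0 (1 - v / h) \<le> 1" using * h by simp
    ultimately show ?thesis using * by simp
  qed
qed

lemma trapezoid_le_1:
  assumes h: "0 < h" and d: "0 < d" "d \<le> 1"
  shows "trapezoid h a d x \<le> 1"
proof -
  obtain m k v w where *: "v = x - a + of_int m" "0 \<le> v" "v < 1" "w = v - d + of_int k" "0 \<le> w" "w < 1"
    "trapezoid h a d x = of_int k + max 0 (1 - w / h) - max 0 (1 - v / h)"
    by (rule trapezoid_cases[OF h, of x a d])
  have w: "max 0 (1 - w / h) \<le> 1" using * h by simp
  have "real_of_int k < 2" using * d by linarith
  then consider "k = 1" | "k \<le> 0" by linarith
  then show ?thesis
  proof cases
    case 1
    then have "v / h \<le> w / h" using * d h by (intro divide_right_mono) auto
    then show ?thesis using * 1 by simp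
  qed (use * w in simp)
qed

lemma trapezoid_le_0:
  assumes h: "0 < h" and d: "0 < d" and a: "0 \<le> a" "a + d + h \<le> 1" and x: "frac x \<notin> {a<..<a + d + h}"
  shows "trapezoid h a d x \<le> 0"
proof -
  define v where "v = (if frac x < a then frac x - a + 1 else frac x - a)"
  have X: "frac x - a + 1 \<ge> 0" "frac x \<ge> 0"
    using a d h frac_ge_0[of x] by linarith+
  obtain m :: int where m: "v = x - a + of_int m"
  proof
    show "v = x - a + of_int (if frac x < a then 1 - floor x else - floor x)"
      by (simp add: v_def frac_def)
  qed
  have v: "0 \<le> v" "v < 1" using a d h X frac_lt_1[of x] unfolding v_def by (auto split: if_splits; linarith)+
  have "d + h \<le> frac x - a + 1" using a X by linarith
  then have "v = 0 \<or> d + h \<le> v" using x unfolding v_def by auto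
  then show ?thesis
  proof
    \<comment> \<open>At the left endpoint \<open>w\<close> wraps around to 1 - d and k = 1. The
      full ramp of \<open>v\<close> cancels this 1, and 1 - d >= h makes the ramp of
      \<open>w\<close> vanish.\<close>
    assume v0: "v = 0"
    have "trapezoid h a d x = of_int 1 + max 0 (1 - (1 - d) / h) - max 0 (1 - v / h)"
      by (rule trapezoid_eq[OF m v]) (use v0 d a h in auto)
    then show ?thesis using v0 h a by (simp add: field_simps)
  next
    assume dv: "d + h \<le> v"
    have "trapezoid h a d x = of_int 0 + max 0 (1 - (v - d) / h) - max 0 (1 - v / h)"
      by (rule trapezoid_eq[OF m v]) (use dv v h d in auto)
    moreover have "max 0 (1 - (v - d) / h) = 0" using dv h by (simp add: field_simps)
    ultimately show ?thesis by simp
  qed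
qed

text \<open>The trapezoid has its plateau on the interval and ramps of width \<open>h\<close>
  outside it, hence mean d + h. The condition on \<open>K\<close> makes the truncation error at most
  \<open>h\<close>, and adding \<open>h\<close> to the zeroth coefficient absorbs it.\<close>

lemma trig_poly_majorant:
  assumes h: "0 < h" "h < 1" and K: "1 / h\<^sup>2 \<le> real K" and d: "0 < d"
  obtains C where "C 0 = complex_of_real (d + 2 * h)" "\<forall>b. b \<noteq> 0 \<longrightarrow> norm (C b) \<le> 1 / (h * of_int b ^ 2)"
    "\<forall>x. trig_poly K C x \<in> \<real>"
    "\<forall>x. indicator {u<..<u + d} (frac x) \<le> Re (trig_poly K C x)"
proof -
  have K0: "0 < K" using K h by (intro Nat.gr0I) (auto simp: field_simps)
  have hK: "1 / (h * real K) \<le> h"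
    using K K0 h by (simp add: field_simps power2_eq_square)
  obtain C where C: "C 0 = complex_of_real (d + h)" "\<forall>b. b \<noteq> 0 \<longrightarrow> norm (C b) \<le> 1 / (h * of_int b ^ 2)"
    "\<forall>x. trig_poly K C x \<in> \<real>" "\<forall>x. \<bar>Re (trig_poly K C x) - trapezoid h (u - h) (d + h) x\<bar> \<le> 1 / (h * real K)"
    by (rule trapezoid_approx[OF h K0, of "d + h" "u - h"])
  have shift: "trig_poly K (C(0 := C 0 + h)) x = trig_poly K C x + h" for x
    unfolding trig_poly_def sum_symmetric_int_interval by simp
  show ?thesis
  proof (rule that[of "C(0 := C 0 + h)"])
    have "indicator {u<..<u + d} (frac x) \<le> Re (trig_poly K (C(0 := C 0 + h)) x)" for x
    proof -
      have "trapezoid h (u - h) (d + h) x \<ge> 1" if "frac x \<in> {u<..<u + d}"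
        using that h d by (intro trapezoid_ge_1) auto
      moreover have "trapezoid h (u - h) (d + h) x \<ge> 0"
        using h d by (intro trapezoid_nonneg) auto
      ultimately have "indicator {u<..<u + d} (frac x) \<le> trapezoid h (u - h) (d + h) x"
        by (auto simp: indicator_def)
      then show ?thesis
        using C(4)[rule_format, of x] hK unfolding shift by simp
    qed
    then show "\<forall>x. indicator {u<..<u + d} (frac x) \<le> Re (trig_poly K (C(0 := C 0 + h)) x)" by blast
  qed (use C shift in auto)
qed

text \<open>Now both ramps lie inside the interval, giving mean d - h, and a further
  \<open>h\<close> is subtracted to absorb the truncation error. Containment in the unit interval
  keeps the trapezoid from wrapping around.\<close>

lemma trig_poly_minorant:
  assumes h: "0 < h" "h < d" and K: "1 / h\<^sup>2 \<le> real K" and u: "0 \<le> u" "u + d \<le> 1"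
  obtains C where "C 0 = complex_of_real (d - 2 * h)" "\<forall>b. b \<noteq> 0 \<longrightarrow> norm (C b) \<le> 1 / (h * of_int b ^ 2)"
    "\<forall>x. trig_poly K C x \<in> \<real>"
    "\<forall>x. Re (trig_poly K C x) \<le> indicator {u<..<u + d} (frac x)"
proof -
  have K0: "0 < K" using K h by (intro Nat.gr0I) (auto simp: field_simps)
  have hK: "1 / (h * real K) \<le> h"
    using K K0 h by (simp add: field_simps power2_eq_square)
  have h1: "h < 1" using h u by simp
  obtain C where C: "C 0 = complex_of_real (d - h)" "\<forall>b. b \<noteq> 0 \<longrightarrow> norm (C b) \<le> 1 / (h * of_int b ^ 2)"
    "\<forall>x. trig_poly K C x \<in> \<real>" "\<forall>x. \<bar>Re (trig_poly K C x) - trapezoid h u (d - h) x\<bar> \<le> 1 / (h * real K)"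
    by (rule trapezoid_approx[OF h(1) h1 K0, of "d - h" u])
  have shift: "trig_poly K (C(0 := C 0 - h)) x = trig_poly K C x - h" for x
    unfolding trig_poly_def sum_symmetric_int_interval by simp
  show ?thesis
  proof (rule that[of "C(0 := C 0 - h)"])
    have "Re (trig_poly K (C(0 := C 0 - h)) x) \<le> indicator {u<..<u + d} (frac x)" for x
    proof -
      have "trapezoid h u (d - h) x \<le> 0" if "frac x \<notin> {u<..<u + d}"
        using that h u by (intro trapezoid_le_0) auto
      moreover have "trapezoid h u (d - h) x \<le> 1"
        using h u by (intro trapezoid_le_1) auto
      ultimately have "trapezoid h u (d - h) x \<le> indicator {u<..<u + d} (frac x)"
        by (auto simp: indicator_def)
      then show ?thesis
        using C(4)[rule_format, of x] hK unfolding shift by simp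
    qed
    then show "\<forall>x. Re (trig_poly K (C(0 := C 0 - h)) x) \<le> indicator {u<..<u + d} (frac x)" by blast
  qed (use C shift in auto)
qed

section \<open>Primes\<close>

lemma prod_primes_dvd:
  fixes n :: nat
  assumes "finite S" "\<And>p. p \<in> S \<Longrightarrow> prime p" "\<And>p. p \<in> S \<Longrightarrow> p dvd n"
  shows "\<Prod>S dvd n"
  using assms
proof (induction S rule: finite_induct)
  case (insert p S)
  have "coprime p (\<Prod>S)"
    using insert by (intro prod_coprime_right) (metis insertCI primes_coprime)
  then show ?case using insert by (simp add: divides_mult)
qed simp

text \<open>The two equal middle entries of row 2m + 1 together are at most the row sum 2 *
  4^m.\<close>

lemma binomial_odd_middle_le: "(2 * m + 1) choose m \<le> 4 ^ m"
proof -
  have "((2 * m + 1) choose m) + ((2 * m + 1) choose (m + 1)) = (\<Sum>k\<in>{m, m + 1}. (2 * m + 1) choose k)"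
    by (simp del: binomial_Suc_Suc)
  also have "\<dots> \<le> (\<Sum>k\<le>2 * m + 1. (2 * m + 1) choose k)"
    by (rule sum_mono2) auto
  also have "\<dots> = 2 * 4 ^ m"
    by (simp only: choose_row_sum) (simp add: power_mult)
  finally show ?thesis
    using binomial_symmetric[of m "2 * m + 1"] by simp
qed

text \<open>The argument of Erdos. An even n > 2 adds no prime; for n = 2m + 1 the primes above m +
  1 all divide the binomial coefficient (2m + 1 choose m), which is at most 4^m, and induction at m
  + 1 supplies 4^(m + 1).\<close>

lemma primorial_le: "\<Prod>{p::nat. prime p \<and> p \<le> n} \<le> 4 ^ n"
proof (induction n rule: less_induct)
  case (less n)
  have fin: "finite {p::nat. prime p \<and> p \<le> k}" for k
    by (rule finite_subset[of _ "{..k}"]) auto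
  have "n \<le> 1 \<or> n = 2 \<or> n > 2 \<and> even n \<or> n = 2 * (n div 2) + 1 \<and> n div 2 \<ge> 1"
    by presburger
  then consider "n \<le> 1" | "n = 2" | "n > 2" "even n" | m where "n = 2 * m + 1" "m \<ge> 1"
    by blast
  then show ?case
  proof cases
    case 1
    then have *: "{p. prime p \<and> p \<le> n} = {}" by (auto dest: prime_gt_1_nat)
    show ?thesis unfolding * by simp
  next
    case 2
    have *: "{p::nat. prime p \<and> p \<le> n} = {2}"
      using 2 by (auto dest: prime_ge_2_nat intro: antisym)
    show ?thesis unfolding * using 2 by simp
  next
    case 3
    then have "\<not> prime n" using primes_dvd_imp_eq two_is_prime_nat by blast
    then have "p \<le> n \<longleftrightarrow> p \<le> n - 1" if "prime p" for p
      using that 3 by (cases "p = n") auto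
    then have *: "{p. prime p \<and> p \<le> n} = {p. prime p \<and> p \<le> n - 1}"
      by blast
    have "\<Prod>{p::nat. prime p \<and> p \<le> n} \<le> 4 ^ (n - 1)"
      unfolding * using 3 by (intro less) auto
    also have "\<dots> \<le> 4 ^ n" by (intro power_increasing) auto
    finally show ?thesis .
  next
    case (4 m)
    define Q where "Q = {p::nat. prime p \<and> m + 1 < p \<and> p \<le> 2 * m + 1}"
    have finQ: "finite Q" unfolding Q_def by (rule finite_subset[of _ "{..2 * m + 1}"]) auto
    have "p dvd (2 * m + 1) choose m" if p: "p \<in> Q" for p
    proof -
      have "p dvd fact (2 * m + 1)" using p by (simp only: Q_def mem_Collect_eq prime_dvd_fact_iff)
      moreover have "2 * m + 1 - m = m + 1" "m \<le> 2 * m + 1" by simp_all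
      ultimately have "p dvd fact m * fact (m + 1) * ((2 * m + 1) choose m)"
        using binomial_fact_lemma[of m "2 * m + 1"] by (simp only:)
      moreover have "\<not> p dvd fact m" "\<not> p dvd fact (m + 1)"
        using p by (auto simp: Q_def prime_dvd_fact_iff simp del: fact_Suc)
      ultimately show ?thesis
        using p by (auto simp: Q_def prime_dvd_mult_iff)
    qed
    then have "\<Prod>Q dvd (2 * m + 1) choose m"
      by (intro prod_primes_dvd finQ) (auto simp: Q_def)
    then have "\<Prod>Q \<le> (2 * m + 1) choose m"
      by (intro dvd_imp_le) auto
    also note binomial_odd_middle_le
    finally have "\<Prod>Q \<le> 4 ^ m" .
    moreover have "\<Prod>{p::nat. prime p \<and> p \<le> m + 1} \<le> 4 ^ (m + 1)"
      using 4 by (intro less) auto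
    moreover have "{p. prime p \<and> p \<le> n} = {p. prime p \<and> p \<le> m + 1} \<union> Q"
      using 4 by (auto simp: Q_def)
    then have "\<Prod>{p. prime p \<and> p \<le> n} = \<Prod>{p. prime p \<and> p \<le> m + 1} * \<Prod>Q"
      by (simp only:) (rule prod.union_disjoint[OF fin finQ], auto simp: Q_def)
    ultimately have "\<Prod>{p. prime p \<and> p \<le> n} \<le> 4 ^ (m + 1) * 4 ^ m"
      by (simp only: mult_le_mono)
    also have "\<dots> = 4 ^ n" using 4 by (simp flip: power_add)
    finally show ?thesis .
  qed
qed

lemma finite_primes_le: "finite {p::nat. prime p \<and> real p \<le> y}"
  by (rule finite_subset[of _ "{..nat \<lfloor>y\<rfloor>}"]) (auto simp: le_nat_floor)

lemma prod_primes_le_powr: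
  assumes "0 \<le> y"
  shows "(\<Prod>p | prime p \<and> real p \<le> y. real p) \<le> 4 powr y"
proof -
  have *: "{p. prime p \<and> real p \<le> y} = {p. prime p \<and> p \<le> nat \<lfloor>y\<rfloor>}"
    using assms by (auto simp: le_nat_floor) linarith
  have "(\<Prod>p | prime p \<and> real p \<le> y. real p) = real (\<Prod>{p. prime p \<and> p \<le> nat \<lfloor>y\<rfloor>})"
    unfolding * by simp
  also have "\<dots> \<le> real (4 ^ nat \<lfloor>y\<rfloor>)"
    unfolding of_nat_le_iff by (rule primorial_le)
  also have "\<dots> = 4 powr real (nat \<lfloor>y\<rfloor>)"
    by (simp add: powr_realpow)
  also have "\<dots> \<le> 4 powr y"
    using assms by (intro powr_mono) auto
  finally show ?thesis .
qed

text \<open>Primes are split at \<open>z\<close>: there are at most \<open>z\<close> of them below,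
  and each one above contributes at least ln z to the sum of ln p, which the primorial bound limits
  to y ln 4.\<close>

lemma prime_count_mult_ln_le:
  assumes "0 \<le> y" "1 \<le> z"
  shows "real (prime_count y) * ln z \<le> z * ln z + y * ln 4"
proof -
  define P where "P = {p::nat. prime p \<and> real p \<le> y}"
  define A where "A = {p \<in> P. real p \<le> z}"
  have fin: "finite P" unfolding P_def by (rule finite_primes_le)
  have sub: "A \<subseteq> P" by (auto simp: A_def)
  have "card A \<le> card {0<..nat \<lfloor>z\<rfloor>}"
    using assms by (intro card_mono) (auto simp: A_def P_def le_nat_floor prime_gt_0_nat)
  then have cardA: "real (card A) \<le> z" using assms by (simp add: le_floor_iff le_nat_iff)
  have "real (card (P - A)) * ln z = (\<Sum>p\<in>P - A. ln z)" by simp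
  also have "\<dots> \<le> (\<Sum>p\<in>P - A. ln (real p))"
    using assms by (intro sum_mono) (auto simp: A_def)
  also have "\<dots> \<le> (\<Sum>p\<in>P. ln (real p))"
    using fin by (intro sum_mono2) (auto simp: P_def Suc_le_eq prime_gt_0_nat)
  also have "\<dots> = ln (\<Prod>p\<in>P. real p)"
    by (rule ln_prod[symmetric]) (use fin in \<open>auto simp: P_def prime_gt_0_nat\<close>)
  also have "\<dots> \<le> ln (4 powr y)"
    using prod_primes_le_powr[OF assms(1)] by (subst ln_le_cancel_iff) (auto simp: P_def prime_gt_0_nat intro!: prod_pos)
  also have "\<dots> = y * ln 4" by (simp add: ln_powr)
  finally have "real (card (P - A)) * ln z \<le> y * ln 4" .
  moreover have "real (card A) * ln z \<le> z * ln z"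
    using cardA assms by (intro mult_right_mono) auto
  moreover have "real (prime_count y) = real (card A) + real (card (P - A))"
    using fin sub by (simp add: prime_count_def P_def[symmetric] card_Diff_subset finite_subset card_mono)
  ultimately show ?thesis by (simp add: distrib_right)
qed

lemma ln_4_less: "ln (4::real) < 14/10"
proof -
  have "ln (4::real) = 2 * ln 2"
    using ln_realpow[of "2::real" 2] by simp
  then show ?thesis using ln2_le_25_over_36 by simp
qed

lemma prime_count_mono: "x \<le> y \<Longrightarrow> prime_count x \<le> prime_count y"
  unfolding prime_count_def by (rule card_mono[OF finite_primes_le]) auto

text \<open>The splitting point is L^(97/100), so that its own contribution is o(L) while only a
  factor 0.97 is lost in the logarithm. With ln 4 < 1.4 this leaves 0.14 / 0.97 < 0.145, and 0.15
  has room for the o(L). Monotonicity gives uniformity in \<open>y\<close>.\<close>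

lemma eventually_prime_count_bound:
  "\<forall>\<^sub>F L in at_top. \<forall>y. y \<le> L / 10 \<longrightarrow> real (prime_count y) * ln L \<le> 15/100 * L"
proof -
  have "\<forall>\<^sub>F L::real in at_top. (L powr (97/100) * (97/100 * ln L) + L / 10 * (14/10)) / (97/100) \<le> 15/100 * L"
    by real_asymp
  then show ?thesis
    using eventually_ge_at_top[of "1::real"]
  proof eventually_elim
    case (elim L)
    have "real (prime_count (L / 10)) * (97/100 * ln L) \<le> L powr (97/100) * (97/100 * ln L) + L / 10 * ln 4"
      using prime_count_mult_ln_le[of "L / 10" "L powr (97/100)"] elim by (simp add: ln_powr ge_one_powr_ge_zero)
    also have "\<dots> \<le> L powr (97/100) * (97/100 * ln L) + L / 10 * (14/10)"
      using elim ln_4_less by (intro add_left_mono mult_left_mono) auto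
    finally have *: "real (prime_count (L / 10)) * ln L \<le> 15/100 * L"
      using elim by (simp add: field_simps)
    show ?case
    proof (intro allI impI)
      fix y assume "y \<le> L / 10"
      then have "real (prime_count y) * ln L \<le> real (prime_count (L / 10)) * ln L"
        using elim by (intro mult_right_mono) (auto intro: prime_count_mono)
      with * show "real (prime_count y) * ln L \<le> 15/100 * L" by simp
    qed
  qed
qed

section \<open>Enumeration of the primes and independence of their logarithms\<close>

lemma nth_prime_bij_betw: "bij_betw nth_prime {1..prime_count y} {p. prime p \<and> real p \<le> y}"
proof -
  define e where "e = enumerate {p::nat. prime p}"
  define P where "P = {p::nat. prime p \<and> real p \<le> y}"
  have inf: "infinite {p::nat. prime p}" by (rule primes_infinite)
  have inj: "inj_on nth_prime {1..prime_count y}"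
  proof (rule inj_onI)
    fix i j assume ij: "i \<in> {1..prime_count y}" "j \<in> {1..prime_count y}" "nth_prime i = nth_prime j"
    then have "i - 1 = j - 1"
      using injD[OF inj_enumerate[OF inf]] unfolding nth_prime_def by blast
    then show "i = j" using ij by auto
  qed
  have "p \<in> nth_prime ` {1..prime_count y}" if p: "p \<in> P" for p
  proof -
    obtain m where m: "e m = p" using enumerate_Ex[OF inf, of p] p by (auto simp: P_def e_def)
    \<comment> \<open>A prime of zero-based index m has m + 1 primes up to itself, all in
      \<open>P\<close>; hence m + 1 is at most \<open>prime_count y\<close> and is its one-based
      index.\<close>
    have "e ` {..m} \<subseteq> P"
    proof safe
      fix i assume "i \<le> m"
      then have "e i \<le> p" using inf m unfolding e_def by (metis enumerate_mono_le_iff)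
      moreover have "e i \<in> {p::nat. prime p}" unfolding e_def by (rule enumerate_in_set[OF inf])
      ultimately show "e i \<in> P" using p by (auto simp: P_def)
    qed
    then have "card (e ` {..m}) \<le> prime_count y"
      unfolding prime_count_def P_def by (rule card_mono[OF finite_primes_le])
    moreover have "card (e ` {..m}) = m + 1"
      unfolding e_def using inj_enumerate[OF inf] by (subst card_image) (auto simp: inj_on_def inj_def)
    ultimately show ?thesis
      using m by (intro image_eqI[of _ _ "m + 1"]) (auto simp: nth_prime_def e_def)
  qed
  then have "P \<subseteq> nth_prime ` {1..prime_count y}" by blast
  moreover have "card (nth_prime ` {1..prime_count y}) = card P"
    using inj by (simp add: card_image prime_count_def P_def)
  ultimately have "P = nth_prime ` {1..prime_count y}"
    by (intro card_subset_eq) auto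
  then show ?thesis using inj by (simp add: bij_betw_def P_def)
qed

text \<open>Unique factorisation: moving the negative coefficients to the other side and
  exponentiating gives two equal prime power products, whose multiplicities at \<open>q\<close>
  agree.\<close>

lemma ln_primes_int_independent:
  fixes m :: "nat \<Rightarrow> int"
  assumes fin: "finite P" and prime: "\<And>p. p \<in> P \<Longrightarrow> prime p"
    and zero: "(\<Sum>p\<in>P. of_int (m p) * ln (real p)) = 0" and q: "q \<in> P"
  shows "m q = 0"
proof -
  define a b where "a p = nat (m p)" and "b p = nat (- m p)" for p
  have pos: "real p > 0" if "p \<in> P" for p using prime[OF that] by (simp add: prime_gt_0_nat)
  have ln_prod_pow: "(\<Sum>p\<in>P. real (f p) * ln (real p)) = ln (real (\<Prod>p\<in>P. p ^ f p))" for f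
    using fin pos by (simp add: ln_prod ln_realpow)
  have "of_int (m p) = real (a p) - real (b p)" for p
    by (auto simp: a_def b_def)
  then have "(\<Sum>p\<in>P. real (a p) * ln (real p)) = (\<Sum>p\<in>P. real (b p) * ln (real p))"
    using zero by (simp add: left_diff_distrib sum_subtractf)
  then have "ln (real (\<Prod>p\<in>P. p ^ a p)) = ln (real (\<Prod>p\<in>P. p ^ b p))"
    by (simp only: ln_prod_pow)
  moreover have "0 < (\<Prod>p\<in>P. p ^ f p)" for f
    using pos by (intro prod_pos) auto
  ultimately have eq: "(\<Prod>p\<in>P. p ^ a p) = (\<Prod>p\<in>P. p ^ b p)"
    by (simp only: ln_inj_iff of_nat_0_less_iff of_nat_eq_iff)
  have "multiplicity q (\<Prod>p\<in>P. p ^ f p) = f q" for f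
    using fin prime q by (subst multiplicity_prod_prime_powers) auto
  then have "a q = b q" using eq by metis
  then show ?thesis by (auto simp: a_def b_def)
qed

lemma common_denominator:
  fixes u :: "'a \<Rightarrow> rat"
  assumes "finite A"
  obtains D m where "D > (0::int)" "\<And>x. x \<in> A \<Longrightarrow> u x * of_int D = of_int (m x)"
proof
  define D where "D = (\<Prod>x\<in>A. snd (quotient_of (u x)))"
  have pos: "snd (quotient_of r) > 0" for r by (metis prod.collapse quotient_of_denom_pos)
  show "D > 0" unfolding D_def using pos by (intro prod_pos) auto
  fix x assume x: "x \<in> A"
  have "D = snd (quotient_of (u x)) * (\<Prod>x\<in>A - {x}. snd (quotient_of (u x)))"
    unfolding D_def using assms x by (rule prod.remove)
  moreover have "u x * of_int (snd (quotient_of (u x))) = of_int (fst (quotient_of (u x)))"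
    using quotient_of_div[of "u x" "fst (quotient_of (u x))" "snd (quotient_of (u x))"] pos[of "u x"]
    by (metis nonzero_eq_divide_eq of_int_0_eq_iff less_irrefl prod.collapse)
  ultimately show "u x * of_int D = of_int (fst (quotient_of (u x)) * (\<Prod>x\<in>A - {x}. snd (quotient_of (u x))))"
    by (simp add: mult.assoc[symmetric])
qed

text \<open>A rational relation becomes an integral one after multiplication by a common
  denominator, and \<open>ln_primes_int_independent\<close> applies.\<close>

lemma rat_lin_independent_ln_primes:
  assumes prime: "\<And>j. j \<in> {1..n} \<Longrightarrow> prime (a j)" and inj: "inj_on a {1..n}"
  shows "rat_lin_independent n (\<lambda>j. ln (real (a j)))"
proof -
  let ?x = "\<lambda>j. ln (real (a j))"
  have pos: "real (a j) > 0" if "j \<in> {1..n}" for j using prime[OF that] by (simp add: prime_gt_0_nat)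
  have injx: "inj_on ?x {1..n}"
  proof (rule inj_onI)
    fix i j assume ij: "i \<in> {1..n}" "j \<in> {1..n}" "ln (real (a i)) = ln (real (a j))"
    then have "a i = a j" using ln_inj_iff[OF pos pos] by (simp only: of_nat_eq_iff)
    then show "i = j" using ij inj_onD[OF inj] by blast
  qed
  interpret Q: module "\<lambda>q r. real_of_rat q * r"
    by unfold_locales (simp_all add: algebra_simps of_rat_add of_rat_mult)
  have "\<forall>v\<in>t. u v = 0" if t: "finite t" "t \<subseteq> ?x ` {1..n}" and 0: "(\<Sum>v\<in>t. real_of_rat (u v) * v) = 0" for t u
  proof -
    \<comment> \<open>The library notion of dependence speaks of a finite set \<open>t\<close> of
      reals; it is pulled back along the injective logarithm to a set of primes.\<close>
    define P where "P = {p \<in> a ` {1..n}. ln (real p) \<in> t}"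
    have finP: "finite P" by (simp add: P_def)
    have injP: "inj_on (\<lambda>p. ln (real p)) P"
    proof (rule inj_onI)
      fix p q assume "p \<in> P" "q \<in> P" and eq: "ln (real p) = ln (real q)"
      then have "real p > 0" "real q > 0" using pos by (auto simp: P_def)
      then show "p = q" using eq by (simp only: ln_inj_iff of_nat_eq_iff)
    qed
    have tP: "t = (\<lambda>p. ln (real p)) ` P"
      using t by (auto simp: P_def)
    obtain D m where D: "D > (0::int)" "\<And>p. p \<in> P \<Longrightarrow> u (ln (real p)) * of_int D = of_int (m p)"
      using common_denominator[OF finP, of "\<lambda>p. u (ln (real p))"] by blast
    have "real_of_int (m p) = real_of_rat (u (ln (real p))) * of_int D" if "p \<in> P" for p
      using arg_cong[OF D(2)[OF that], of real_of_rat] by (simp add: of_rat_mult)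
    then have "(\<Sum>p\<in>P. of_int (m p) * ln (real p)) = of_int D * (\<Sum>p\<in>P. real_of_rat (u (ln (real p))) * ln (real p))"
      by (simp add: sum_distrib_left mult_ac)
    also have "(\<Sum>p\<in>P. real_of_rat (u (ln (real p))) * ln (real p)) = 0"
      using 0 unfolding tP by (subst (asm) sum.reindex[OF injP]) simp
    finally have zero: "(\<Sum>p\<in>P. of_int (m p) * ln (real p)) = 0" by simp
    have "m p = 0" if "p \<in> P" for p
      by (rule ln_primes_int_independent[OF finP _ zero that]) (use prime in \<open>auto simp: P_def\<close>)
    then show ?thesis using D by (auto simp: tP)
  qed
  then show ?thesis
    unfolding rat_lin_independent_def Q.dependent_explicit using injx by blast
qed

section \<open>Mean values of products of trigonometric polynomials\<close>

text \<open>An explicit primitive gives a bound that does not grow with the length of the interval,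
  so a nonzero frequency competes with the main term only through the smallness of
  \<open>x\<close>.\<close>

lemma norm_integral_cis_le:
  fixes a b x :: real
  assumes "a \<le> b" "x \<noteq> 0"
  shows "norm (integral {a..b} (\<lambda>t. cis (t * x))) \<le> 2 / \<bar>x\<bar>"
proof -
  have "((\<lambda>z. exp (\<i> * z * of_real x) / (\<i> * of_real x)) has_field_derivative exp (\<i> * of_real t * of_real x)) (at (of_real t))" for t
    using assms(2) by (auto intro!: derivative_eq_intros)
  from has_vector_derivative_real_field[OF this]
  have "((\<lambda>t. cis (t * x) / (\<i> * of_real x)) has_vector_derivative cis (t * x)) (at t within {a..b})" for t
    by (simp add: cis_conv_exp mult.assoc)
  then have "((\<lambda>t. cis (t * x)) has_integral (cis (b * x) / (\<i> * of_real x) - cis (a * x) / (\<i> * of_real x))) {a..b}"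
    using assms(1) by (intro fundamental_theorem_of_calculus)
  then have "integral {a..b} (\<lambda>t. cis (t * x)) = (cis (b * x) - cis (a * x)) / (\<i> * of_real x)"
    by (simp add: integral_unique diff_divide_distrib)
  also have "norm \<dots> \<le> 2 / \<bar>x\<bar>"
    using norm_triangle_ineq4[of "cis (b * x)" "cis (a * x)"]
    by (simp add: norm_divide norm_mult divide_right_mono)
  finally show ?thesis .
qed

lemma prod_cis: "finite J \<Longrightarrow> (\<Prod>j\<in>J. cis (f j)) = cis (\<Sum>j\<in>J. f j)"
  by (induction J rule: finite_induct) (simp_all add: cis_mult)

lemma prod_trig_poly:
  assumes "finite J"
  shows "(\<Prod>j\<in>J. trig_poly K (C j) (t * \<omega> j / (2 * pi)))
    = (\<Sum>\<beta>\<in>PiE J (\<lambda>_. {- int K..int K}). (\<Prod>j\<in>J. C j (\<beta> j)) * cis (t * (\<Sum>j\<in>J. of_int (\<beta> j) * \<omega> j)))"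
proof -
  have "trig_poly K (C j) (t * \<omega> j / (2 * pi)) = (\<Sum>b\<in>{- int K..int K}. C j b * cis (t * (of_int b * \<omega> j)))" for j
    unfolding trig_poly_def by (intro sum.cong refl) (simp add: mult_ac)
  then show ?thesis
    using assms by (simp add: prod_sum_PiE prod.distrib prod_cis sum_distrib_left)
qed

text \<open>Only the frequency \<open>\<beta> = 0\<close> contributes to the main term; the lower bound on the other
  frequencies factorises over \<open>J\<close>, so the error is again a product.\<close>

lemma integral_prod_trig_poly:
  fixes T T' \<kappa> :: real and w :: "int \<Rightarrow> real"
  assumes fin: "finite J" and T: "T \<le> T'" and \<kappa>: "\<kappa> > 0" and w: "\<And>b. w b > 0"
    and lower: "\<And>\<beta>. \<exists>j\<in>J. \<beta> j \<noteq> 0 \<Longrightarrow>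
        \<bar>\<Sum>j\<in>J. of_int (\<beta> j) * \<omega> j\<bar> \<ge> \<kappa> / (\<Prod>j\<in>J. w (\<beta> j))"
    and C0: "\<And>j. j \<in> J \<Longrightarrow> C j 0 = of_real (c j)"
    and A: "\<And>j. j \<in> J \<Longrightarrow> (\<Sum>b\<in>{- int K..int K}. norm (C j b) * w b) \<le> A j"
    and real: "\<And>j x. j \<in> J \<Longrightarrow> trig_poly K (C j) x \<in> \<real>"
  shows "(\<lambda>t. \<Prod>j\<in>J. Re (trig_poly K (C j) (t * \<omega> j / (2 * pi)))) integrable_on {T..T'}"
    and "\<bar>integral {T..T'} (\<lambda>t. \<Prod>j\<in>J. Re (trig_poly K (C j) (t * \<omega> j / (2 * pi))))
      - (T' - T) * (\<Prod>j\<in>J. c j)\<bar> \<le> 2 / \<kappa> * (\<Prod>j\<in>J. A j)"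
proof -
  define S where "S = PiE J (\<lambda>_. {- int K..int K})"
  define \<Lambda> where "\<Lambda> \<beta> = (\<Sum>j\<in>J. of_int (\<beta> j) * \<omega> j)" for \<beta> :: "'a \<Rightarrow> int"
  define z where "z = (\<lambda>j\<in>J. 0::int)"
  define f where "f t = (\<Prod>j\<in>J. Re (trig_poly K (C j) (t * \<omega> j / (2 * pi))))" for t
  have w0: "0 \<le> w b" for b using w[of b] by simp
  have finS: "finite S" unfolding S_def using fin by (intro finite_PiE) auto
  have zS: "z \<in> S" by (auto simp: S_def z_def)
  have f_eq: "complex_of_real (f t) = (\<Sum>\<beta>\<in>S. (\<Prod>j\<in>J. C j (\<beta> j)) * cis (t * \<Lambda> \<beta>))" for t
  proof -
    have "complex_of_real (f t) = (\<Prod>j\<in>J. trig_poly K (C j) (t * \<omega> j / (2 * pi)))"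
      unfolding f_def of_real_prod using real by (intro prod.cong refl) (simp add: of_real_Re)
    then show ?thesis
      by (simp add: prod_trig_poly[OF fin] S_def \<Lambda>_def)
  qed
  have cont: "continuous_on {T..T'} (\<lambda>t. cis (t * x))" for x
    by (intro continuous_intros)
  have cint: "(\<lambda>t. cis (t * x)) integrable_on {T..T'}" for x
    by (rule integrable_continuous_real[OF cont])
  have "(\<lambda>t. complex_of_real (f t)) integrable_on {T..T'}"
    unfolding f_eq by (intro integrable_sum finS integrable_on_mult_right cint)
  from integrable_linear[OF this bounded_linear_Re] have fint: "f integrable_on {T..T'}"
    by (simp add: o_def)
  then show "(\<lambda>t. \<Prod>j\<in>J. Re (trig_poly K (C j) (t * \<omega> j / (2 * pi)))) integrable_on {T..T'}"
    by (simp add: f_def[abs_def])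
  have "complex_of_real (integral {T..T'} f) = integral {T..T'} (\<lambda>t. complex_of_real (f t))"
    using integral_linear[OF fint, of complex_of_real] by (simp add: o_def bounded_linear_of_real)
  also have "\<dots> = (\<Sum>\<beta>\<in>S. (\<Prod>j\<in>J. C j (\<beta> j)) * integral {T..T'} (\<lambda>t. cis (t * \<Lambda> \<beta>)))"
    unfolding f_eq by (subst integral_sum) (auto intro: finS integrable_on_mult_right cint)
  also have "\<dots> = (\<Prod>j\<in>J. C j (z j)) * integral {T..T'} (\<lambda>t. cis (t * \<Lambda> z))
      + (\<Sum>\<beta>\<in>S - {z}. (\<Prod>j\<in>J. C j (\<beta> j)) * integral {T..T'} (\<lambda>t. cis (t * \<Lambda> \<beta>)))"
    by (rule sum.remove[OF finS zS])
  also have "(\<Prod>j\<in>J. C j (z j)) * integral {T..T'} (\<lambda>t. cis (t * \<Lambda> z)) = of_real ((T' - T) * (\<Prod>j\<in>J. c j))"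
  proof -
    have "\<Lambda> z = 0" unfolding \<Lambda>_def z_def by (rule sum.neutral) auto
    moreover have "(\<Prod>j\<in>J. C j (z j)) = (\<Prod>j\<in>J. of_real (c j))"
      using C0 by (intro prod.cong) (auto simp: z_def)
    ultimately show ?thesis using T by (simp add: mult.commute scaleR_conv_of_real)
  qed
  finally have "complex_of_real (integral {T..T'} f - (T' - T) * (\<Prod>j\<in>J. c j))
     = (\<Sum>\<beta>\<in>S - {z}. (\<Prod>j\<in>J. C j (\<beta> j)) * integral {T..T'} (\<lambda>t. cis (t * \<Lambda> \<beta>)))"
    by simp
  then have "\<bar>integral {T..T'} f - (T' - T) * (\<Prod>j\<in>J. c j)\<bar>
     = norm (\<Sum>\<beta>\<in>S - {z}. (\<Prod>j\<in>J. C j (\<beta> j)) * integral {T..T'} (\<lambda>t. cis (t * \<Lambda> \<beta>)))"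
    by (metis norm_of_real real_norm_def)
  also have "\<dots> \<le> (\<Sum>\<beta>\<in>S - {z}. 2 / \<kappa> * (\<Prod>j\<in>J. norm (C j (\<beta> j)) * w (\<beta> j)))"
  proof (rule sum_norm_le)
    fix \<beta> assume \<beta>: "\<beta> \<in> S - {z}"
    have "\<exists>j\<in>J. \<beta> j \<noteq> 0"
    proof (rule ccontr)
      assume "\<not> ?thesis"
      then have "\<beta> = z" using \<beta> by (auto simp: S_def z_def PiE_def extensional_def fun_eq_iff)
      with \<beta> show False by simp
    qed
    then have low: "\<kappa> / (\<Prod>j\<in>J. w (\<beta> j)) \<le> \<bar>\<Lambda> \<beta>\<bar>" unfolding \<Lambda>_def by (rule lower)
    have W: "(\<Prod>j\<in>J. w (\<beta> j)) > 0" using w by (intro prod_pos) auto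
    have pos: "0 < \<kappa> / (\<Prod>j\<in>J. w (\<beta> j))" using \<kappa> W by simp
    have "norm (integral {T..T'} (\<lambda>t. cis (t * \<Lambda> \<beta>))) \<le> 2 / \<bar>\<Lambda> \<beta>\<bar>"
      using pos low T by (intro norm_integral_cis_le) auto
    also have "\<dots> \<le> 2 / (\<kappa> / (\<Prod>j\<in>J. w (\<beta> j)))"
      using pos low by (intro divide_left_mono mult_pos_pos) auto
    finally have "norm (integral {T..T'} (\<lambda>t. cis (t * \<Lambda> \<beta>))) \<le> 2 / \<kappa> * (\<Prod>j\<in>J. w (\<beta> j))"
      by simp
    then have "norm (\<Prod>j\<in>J. C j (\<beta> j)) * norm (integral {T..T'} (\<lambda>t. cis (t * \<Lambda> \<beta>)))
        \<le> norm (\<Prod>j\<in>J. C j (\<beta> j)) * (2 / \<kappa> * (\<Prod>j\<in>J. w (\<beta> j)))"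
      by (rule mult_left_mono) simp
    then show "norm ((\<Prod>j\<in>J. C j (\<beta> j)) * integral {T..T'} (\<lambda>t. cis (t * \<Lambda> \<beta>)))
        \<le> 2 / \<kappa> * (\<Prod>j\<in>J. norm (C j (\<beta> j)) * w (\<beta> j))"
      by (simp add: norm_mult prod.distrib prod_norm[symmetric] mult_ac)
  qed
  \<comment> \<open>Restoring the nonnegative term at \<open>z\<close> turns the index set back into
    a full box, over which the sum of products is a product of sums.\<close>
  also have "\<dots> \<le> (\<Sum>\<beta>\<in>S. 2 / \<kappa> * (\<Prod>j\<in>J. norm (C j (\<beta> j)) * w (\<beta> j)))"
    using finS \<kappa> w0 by (intro sum_mono2) (auto intro!: divide_nonneg_pos mult_nonneg_nonneg prod_nonneg)
  also have "\<dots> = 2 / \<kappa> * (\<Prod>j\<in>J. \<Sum>b\<in>{- int K..int K}. norm (C j b) * w b)"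
    unfolding S_def sum_distrib_left[symmetric] using fin by (simp add: prod_sum_PiE)
  also have "\<dots> \<le> 2 / \<kappa> * (\<Prod>j\<in>J. A j)"
    using A \<kappa> w0 by (intro mult_left_mono prod_mono) (auto intro!: sum_nonneg mult_nonneg_nonneg)
  finally show "\<bar>integral {T..T'} (\<lambda>t. \<Prod>j\<in>J. Re (trig_poly K (C j) (t * \<omega> j / (2 * pi))))
      - (T' - T) * (\<Prod>j\<in>J. c j)\<bar> \<le> 2 / \<kappa> * (\<Prod>j\<in>J. A j)"
    by (simp add: f_def[abs_def])
qed

section \<open>Comparison of products, and the measure as an integral of indicators\<close>

lemma prod_diff_le_sum:
  fixes x y :: "'a \<Rightarrow> real"
  assumes "finite J" "\<And>j. j \<in> J \<Longrightarrow> 0 \<le> x j" "\<And>j. j \<in> J \<Longrightarrow> x j \<le> y j"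
  shows "(\<Prod>j\<in>J. y j) - (\<Prod>j\<in>J. x j) \<le> (\<Sum>i\<in>J. (y i - x i) * (\<Prod>j\<in>J - {i}. y j))"
  using assms
proof (induction J rule: finite_induct)
  case (insert k J)
  have IH: "(\<Prod>j\<in>J. y j) - (\<Prod>j\<in>J. x j) \<le> (\<Sum>i\<in>J. (y i - x i) * (\<Prod>j\<in>J - {i}. y j))"
    using insert by auto
  have le: "(\<Prod>j\<in>J. x j) \<le> (\<Prod>j\<in>J. y j)"
    using insert by (intro prod_mono) auto
  have yk: "0 \<le> y k" using insert.prems(1)[of k] insert.prems(2)[of k] by simp
  have "(y i - x i) * (\<Prod>j\<in>insert k J - {i}. y j) = y k * ((y i - x i) * (\<Prod>j\<in>J - {i}. y j))" if "i \<in> J" for i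
  proof -
    have "insert k J - {i} = insert k (J - {i})" using that insert.hyps by auto
    then show ?thesis using insert.hyps by simp
  qed
  then have "(\<Sum>i\<in>J. (y i - x i) * (\<Prod>j\<in>insert k J - {i}. y j))
      = (\<Sum>i\<in>J. y k * ((y i - x i) * (\<Prod>j\<in>J - {i}. y j)))"
    by (rule sum.cong[OF refl])
  then have "(\<Sum>i\<in>insert k J. (y i - x i) * (\<Prod>j\<in>insert k J - {i}. y j))
      = (y k - x k) * (\<Prod>j\<in>J. y j) + y k * (\<Sum>i\<in>J. (y i - x i) * (\<Prod>j\<in>J - {i}. y j))"
    using insert.hyps by (simp add: sum_distrib_left)
  also have "\<dots> \<ge> (y k - x k) * (\<Prod>j\<in>J. y j) + y k * ((\<Prod>j\<in>J. y j) - (\<Prod>j\<in>J. x j))"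
    by (intro add_left_mono mult_left_mono IH yk)
  also have "(y k - x k) * (\<Prod>j\<in>J. y j) + y k * ((\<Prod>j\<in>J. y j) - (\<Prod>j\<in>J. x j))
      = y k * (\<Prod>j\<in>J. y j) - x k * (\<Prod>j\<in>J. x j) + (y k - x k) * ((\<Prod>j\<in>J. y j) - (\<Prod>j\<in>J. x j))"
    by (simp add: algebra_simps)
  \<comment> \<open>The dropped cross term is a product of two nonnegative differences.\<close>
  also have "\<dots> \<ge> y k * (\<Prod>j\<in>J. y j) - x k * (\<Prod>j\<in>J. x j)"
    using le insert.prems(2)[of k] by simp
  finally show ?case
    using insert.hyps by simp
qed simp

lemma borel_measurable_frac [measurable]: "(frac :: real \<Rightarrow> real) \<in> borel_measurable borel"
  unfolding frac_def[abs_def] by measurable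

lemma Kronecker_measure_integral:
  assumes "\<And>j. j \<in> {1..prime_count y} \<Longrightarrow> open (I j)"
  defines "g \<equiv> (\<lambda>t. \<Prod>j\<in>{1..prime_count y}. indicator (I j) (frac (t * ln (real (nth_prime j)) / (2 * pi))) :: real)"
  shows "g integrable_on {T..2 * T}" "Kronecker_measure T y I = integral {T..2 * T} g"
proof -
  define S where "S = {t. \<forall>j\<in>{1..prime_count y}. frac (t * ln (real (nth_prime j)) / (2 * pi)) \<in> I j}"
  have "S = (\<Inter>j\<in>{1..prime_count y}. (\<lambda>t. frac (t * ln (real (nth_prime j)) / (2 * pi))) -` I j \<inter> space borel) \<inter> UNIV"
    by (auto simp: S_def)
  moreover have "(\<lambda>t. frac (t * ln (real (nth_prime j)) / (2 * pi))) -` I j \<inter> space borel \<in> sets borel"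
    if "j \<in> {1..prime_count y}" for j
    by (rule measurable_sets[of _ borel borel]) (use assms(1)[OF that] in auto)
  ultimately have Sb: "S \<in> sets borel"
    \<comment> \<open>The empty index set is treated apart: the intersection is then all of
      \<open>UNIV\<close>, while \<open>sets.finite_INT\<close> asks for a nonempty family.\<close>
    by (cases "prime_count y = 0") (auto intro!: sets.finite_INT)
  have g: "g = indicator S"
  proof
    fix t show "g t = indicator S t"
      by (cases "t \<in> S") (auto simp: g_def S_def indicator_def intro!: prod.neutral)
  qed
  have meas: "{T..2 * T} \<inter> S \<in> lmeasurable"
    using Sb by (intro bounded_set_imp_lmeasurable bounded_Int) auto
  then show "g integrable_on {T..2 * T}"
    unfolding g by (simp add: integrable_on_indicator Int_commute)
  have "Kronecker_measure T y I = measure lebesgue (S \<inter> {T..2 * T})"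
    unfolding Kronecker_measure_def by (rule arg_cong[of _ _ "measure lebesgue"]) (auto simp: S_def)
  then show "Kronecker_measure T y I = integral {T..2 * T} g"
    unfolding g using meas by (simp add: integral_indicator Int_commute)
qed

section \<open>Applying the conjecture\<close>

text \<open>The maximum in the numerator is at least 1 and the product of the primes is at most 4^y;
  inserting both makes the dependence on \<beta> a pure product over j, the shape that
  \<open>integral_prod_trig_poly\<close> needs. The constant is chosen before \<open>y\<close>,
  which keeps the result uniform.\<close>

lemma Lang_Waldschmidt_primes:
  assumes "Lang_Waldschmidt_conjecture" "\<epsilon> > 0"
  obtains c where "c > 0"
    "\<And>y (\<beta> :: nat \<Rightarrow> int). \<lbrakk>0 \<le> y; \<exists>j\<in>{1..prime_count y}. \<beta> j \<noteq> 0\<rbrakk> \<Longrightarrow>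
      c ^ prime_count y / (4 powr y) powr (1 + \<epsilon>) / (\<Prod>j\<in>{1..prime_count y}. of_int (max \<bar>\<beta> j\<bar> 1) powr (1 + \<epsilon>))
        \<le> \<bar>\<Sum>j\<in>{1..prime_count y}. of_int (\<beta> j) * ln (real (nth_prime j))\<bar>"
proof -
  obtain c where c: "c > 0" and LW: "\<forall>(n::nat) (b::nat \<Rightarrow> int) (a::nat \<Rightarrow> nat).
      n \<ge> 1 \<longrightarrow> (\<forall>j\<in>{1..n}. a j > 0) \<longrightarrow> rat_lin_independent n (\<lambda>j. ln (real (a j))) \<longrightarrow> (\<exists>j\<in>{1..n}. b j \<noteq> 0)
      \<longrightarrow> \<bar>\<Sum>j=1..n. of_int (b j) * ln (real (a j))\<bar> >
          c ^ n * of_int (Max ((\<lambda>j. max \<bar>b j\<bar> 1) ` {1..n})) /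
          ((\<Prod>j=1..n. of_int (max \<bar>b j\<bar> 1)) * (\<Prod>j=1..n. real (a j))) powr (1 + \<epsilon>)"
    using assms(1)[unfolded Lang_Waldschmidt_conjecture_def Let_def, THEN spec, THEN mp, OF assms(2)]
    by (elim exE conjE)
  show ?thesis
  proof (rule that[OF c])
    fix y and \<beta> :: "nat \<Rightarrow> int"
    assume y: "0 \<le> y" and nz: "\<exists>j\<in>{1..prime_count y}. \<beta> j \<noteq> 0"
    define N where "N = prime_count y"
    have bij: "bij_betw nth_prime {1..N} {p. prime p \<and> real p \<le> y}"
      unfolding N_def by (rule nth_prime_bij_betw)
    have prime: "prime (nth_prime j)" if "j \<in> {1..N}" for j
      using bij_betwE[OF bij] that by blast
    have N: "N \<ge> 1" using nz by (auto simp: N_def)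
    define B where "B = (\<Prod>j=1..N. real_of_int (max \<bar>\<beta> j\<bar> 1))"
    define P where "P = (\<Prod>j=1..N. real (nth_prime j))"
    have B: "B > 0" unfolding B_def by (intro prod_pos) auto
    have P: "P > 0" unfolding P_def using prime by (intro prod_pos) (auto simp: prime_gt_0_nat)
    have "P = (\<Prod>p | prime p \<and> real p \<le> y. real p)"
      unfolding P_def by (rule prod.reindex_bij_betw[OF bij])
    then have P_le: "P \<le> 4 powr y" using prod_primes_le_powr[OF y] by simp
    have "max \<bar>\<beta> 1\<bar> 1 \<le> Max ((\<lambda>j. max \<bar>\<beta> j\<bar> 1) ` {1..N})"
      using N by (intro Max_ge) auto
    then have "1 \<le> Max ((\<lambda>j. max \<bar>\<beta> j\<bar> 1) ` {1..N})"
      by linarith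
    then have Max: "1 \<le> real_of_int (Max ((\<lambda>j. max \<bar>\<beta> j\<bar> 1) ` {1..N}))"
      by (simp only: of_int_1_le_iff)
    have "(\<Prod>j\<in>{1..N}. real_of_int (max \<bar>\<beta> j\<bar> 1) powr (1 + \<epsilon>)) = B powr (1 + \<epsilon>)"
      unfolding B_def by (rule prod_powr_distrib[symmetric])
    then have "c ^ N / (4 powr y) powr (1 + \<epsilon>) / (\<Prod>j\<in>{1..N}. of_int (max \<bar>\<beta> j\<bar> 1) powr (1 + \<epsilon>))
        = c ^ N * 1 / (B powr (1 + \<epsilon>) * (4 powr y) powr (1 + \<epsilon>))"
      by (simp add: mult.commute)
    also have "\<dots> \<le> c ^ N * of_int (Max ((\<lambda>j. max \<bar>\<beta> j\<bar> 1) ` {1..N})) / (B powr (1 + \<epsilon>) * P powr (1 + \<epsilon>))"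
      using c B P P_le Max assms(2)
      by (intro frac_le mult_left_mono mult_nonneg_nonneg powr_mono2 mult_pos_pos) auto
    also have "\<dots> = c ^ N * of_int (Max ((\<lambda>j. max \<bar>\<beta> j\<bar> 1) ` {1..N})) / (B * P) powr (1 + \<epsilon>)"
      using B P by (simp add: powr_mult)
    also have "\<dots> \<le> \<bar>\<Sum>j=1..N. of_int (\<beta> j) * ln (real (nth_prime j))\<bar>"
      unfolding B_def P_def
    proof (rule less_imp_le, rule LW[THEN spec, THEN spec, THEN spec, THEN mp, THEN mp, THEN mp, THEN mp, OF N])
      show "\<forall>j\<in>{1..N}. 0 < nth_prime j" using prime by (auto simp: prime_gt_0_nat)
      show "rat_lin_independent N (\<lambda>j. ln (real (nth_prime j)))"
        using prime bij by (intro rat_lin_independent_ln_primes) (auto simp: bij_betw_def)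
      show "\<exists>j\<in>{1..N}. \<beta> j \<noteq> 0" using nz by (simp add: N_def)
    qed
    finally show "c ^ prime_count y / (4 powr y) powr (1 + \<epsilon>) / (\<Prod>j\<in>{1..prime_count y}. of_int (max \<bar>\<beta> j\<bar> 1) powr (1 + \<epsilon>))
        \<le> \<bar>\<Sum>j\<in>{1..prime_count y}. of_int (\<beta> j) * ln (real (nth_prime j))\<bar>"
      by (simp only: N_def)
  qed
qed

text \<open>The weight |b|^(1 + \<epsilon>) against the decay 1 / b^2 leaves |b|^(\<epsilon> - 1),
  at most K^\<epsilon> times a harmonic term. The factor 2 in the coefficient bound allows for
  differences of a majorant and a minorant.\<close>

lemma weighted_coefficient_sum_le:
  fixes C :: "int \<Rightarrow> complex"
  assumes h: "0 < h" and \<epsilon>: "0 < \<epsilon>" and K: "0 < K" and C0: "norm (C 0) \<le> a"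
    and C: "\<And>b. b \<noteq> 0 \<Longrightarrow> norm (C b) \<le> 2 / (h * of_int b ^ 2)"
  shows "(\<Sum>b\<in>{- int K..int K}. norm (C b) * of_int (max \<bar>b\<bar> 1) powr (1 + \<epsilon>))
    \<le> a + 4 / h * (real K powr \<epsilon> * (1 + ln (real K)))"
proof -
  have term_le: "norm (C s) * of_int (max \<bar>s\<bar> 1) powr (1 + \<epsilon>) \<le> 2 / h * (real K powr \<epsilon> * (1 / real b))"
    if b: "b \<in> {1..K}" and s: "\<bar>s\<bar> = int b" for b s
  proof -
    have "max \<bar>s\<bar> 1 = int b" using b s by auto
    then have weight: "of_int (max \<bar>s\<bar> 1) powr (1 + \<epsilon>) = real b * real b powr \<epsilon>"
      using b by (simp add: powr_add)
    have square: "real_of_int s ^ 2 = real b ^ 2"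
      using s by (metis of_int_abs of_int_of_nat_eq power2_abs)
    have "norm (C s) * of_int (max \<bar>s\<bar> 1) powr (1 + \<epsilon>) \<le> 2 / (h * of_int s ^ 2) * of_int (max \<bar>s\<bar> 1) powr (1 + \<epsilon>)"
      using b s by (intro mult_right_mono C) auto
    also have "\<dots> = 2 / h * (real b powr \<epsilon> * (1 / real b))"
      unfolding weight square using b h by (simp add: field_simps power2_eq_square)
    also have "\<dots> \<le> 2 / h * (real K powr \<epsilon> * (1 / real b))"
      using b h \<epsilon> by (intro mult_left_mono mult_right_mono powr_mono2) auto
    finally show ?thesis .
  qed
  have "(\<Sum>b\<in>{- int K..int K}. norm (C b) * of_int (max \<bar>b\<bar> 1) powr (1 + \<epsilon>))
      \<le> a + (\<Sum>b=1..K. 2 / h * (real K powr \<epsilon> * (1 / real b)) + 2 / h * (real K powr \<epsilon> * (1 / real b)))"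
    unfolding sum_symmetric_int_interval
    by (intro add_mono sum_mono term_le) (use C0 in auto)
  also have "\<dots> = a + 4 / h * (real K powr \<epsilon> * harm K)"
    by (simp add: harm_def sum_distrib_left field_simps)
  also have "\<dots> \<le> a + 4 / h * (real K powr \<epsilon> * (1 + ln (real K)))"
  proof -
    \<comment> \<open>The sequence \<open>harm\<close> n - ln n decreases from its value 1 at n =
      1.\<close>
    have "harm K - ln (real K) \<le> (1::real)"
      using euler_mascheroni_sequence_decreasing[of 1 K] K by (simp add: harm_def)
    then show ?thesis
      using h by (intro add_left_mono mult_left_mono) auto
  qed
  finally show ?thesis .
qed

lemma trig_poly_diff: "trig_poly K (\<lambda>b. C b - D b) x = trig_poly K C x - trig_poly K D x"
  by (simp add: trig_poly_def left_diff_distrib sum_subtractf)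

text \<open>One integral is taken for the product of majorants and one for each index i of the
  telescoped difference. Their zeroth coefficients, \<delta> j + 2h or 4h, are at most 4 and the
  others at most 2 / (h b^2), so the single hypothesis \<open>A\<close> covers them all with the
  same error; hence the factor 1 + card J.\<close>

lemma Kronecker_measure_bounds:
  fixes T y h \<kappa> A :: real and w :: "int \<Rightarrow> real" and \<delta> u :: "nat \<Rightarrow> real"
  defines "J \<equiv> {1..prime_count y}"
  assumes T: "0 \<le> T" and \<kappa>: "\<kappa> > 0" and w: "\<And>b. w b > 0"
    and lower: "\<And>\<beta>. \<exists>j\<in>J. \<beta> j \<noteq> 0 \<Longrightarrow>
        \<kappa> / (\<Prod>j\<in>J. w (\<beta> j)) \<le> \<bar>\<Sum>j\<in>J. of_int (\<beta> j) * ln (real (nth_prime j))\<bar>"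
    and h: "0 < h" "h < 1" and K: "1 / h\<^sup>2 \<le> real K"
    and I: "\<And>j. j \<in> J \<Longrightarrow> I j = {u j<..<u j + \<delta> j}"
    and u: "\<And>j. j \<in> J \<Longrightarrow> 0 \<le> u j" "\<And>j. j \<in> J \<Longrightarrow> u j + \<delta> j \<le> 1"
    and \<delta>: "\<And>j. j \<in> J \<Longrightarrow> h < \<delta> j"
    and A: "\<And>C :: int \<Rightarrow> complex. \<lbrakk>norm (C 0) \<le> 4; \<And>b. b \<noteq> 0 \<Longrightarrow> norm (C b) \<le> 2 / (h * of_int b ^ 2)\<rbrakk>
        \<Longrightarrow> (\<Sum>b\<in>{- int K..int K}. norm (C b) * w b) \<le> A"
  shows "Kronecker_measure T y I \<le> T * (\<Prod>j\<in>J. \<delta> j + 2 * h) + 2 / \<kappa> * A ^ card J"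
    and "Kronecker_measure T y I \<ge> T * (\<Prod>j\<in>J. \<delta> j + 2 * h)
        - (\<Sum>i\<in>J. T * (4 * h * (\<Prod>j\<in>J - {i}. \<delta> j + 2 * h))) - (1 + real (card J)) * (2 / \<kappa> * A ^ card J)"
proof -
  have finJ: "finite J" by (simp add: J_def)
  let ?\<omega> = "\<lambda>j. ln (real (nth_prime j))"
  have "\<forall>j\<in>J. \<exists>C. C 0 = complex_of_real (\<delta> j + 2 * h) \<and> (\<forall>b. b \<noteq> 0 \<longrightarrow> norm (C b) \<le> 1 / (h * of_int b ^ 2)) \<and>
      (\<forall>x. trig_poly K C x \<in> \<real>) \<and> (\<forall>x. indicator (I j) (frac x) \<le> Re (trig_poly K C x))"
  proof
    fix j assume j: "j \<in> J"
    show "\<exists>C. C 0 = complex_of_real (\<delta> j + 2 * h) \<and> (\<forall>b. b \<noteq> 0 \<longrightarrow> norm (C b) \<le> 1 / (h * of_int b ^ 2)) \<and>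
      (\<forall>x. trig_poly K C x \<in> \<real>) \<and> (\<forall>x. indicator (I j) (frac x) \<le> Re (trig_poly K C x))"
      unfolding I[OF j]
      by (rule trig_poly_majorant[OF h K, of "\<delta> j" "u j"]) (use \<delta>[OF j] h in auto)
  qed
  from bchoice[OF this] obtain Cp where Cp_all: "\<forall>j\<in>J. Cp j 0 = complex_of_real (\<delta> j + 2 * h) \<and>
      (\<forall>b. b \<noteq> 0 \<longrightarrow> norm (Cp j b) \<le> 1 / (h * of_int b ^ 2)) \<and>
      (\<forall>x. trig_poly K (Cp j) x \<in> \<real>) \<and> (\<forall>x. indicator (I j) (frac x) \<le> Re (trig_poly K (Cp j) x))"
    by (elim exE)
  have Cp0: "Cp j 0 = complex_of_real (\<delta> j + 2 * h)"
    and Cp: "\<And>b. b \<noteq> 0 \<Longrightarrow> norm (Cp j b) \<le> 1 / (h * of_int b ^ 2)"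
    and Cp_real: "\<And>x. trig_poly K (Cp j) x \<in> \<real>"
    and Cp_ge: "\<And>x. indicator (I j) (frac x) \<le> Re (trig_poly K (Cp j) x)" if "j \<in> J" for j
    using bspec[OF Cp_all that] by simp_all
  have "\<forall>j\<in>J. \<exists>C. C 0 = complex_of_real (\<delta> j - 2 * h) \<and> (\<forall>b. b \<noteq> 0 \<longrightarrow> norm (C b) \<le> 1 / (h * of_int b ^ 2)) \<and>
      (\<forall>x. trig_poly K C x \<in> \<real>) \<and> (\<forall>x. Re (trig_poly K C x) \<le> indicator (I j) (frac x))"
  proof
    fix j assume j: "j \<in> J"
    show "\<exists>C. C 0 = complex_of_real (\<delta> j - 2 * h) \<and> (\<forall>b. b \<noteq> 0 \<longrightarrow> norm (C b) \<le> 1 / (h * of_int b ^ 2)) \<and>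
      (\<forall>x. trig_poly K C x \<in> \<real>) \<and> (\<forall>x. Re (trig_poly K C x) \<le> indicator (I j) (frac x))"
      unfolding I[OF j]
      by (rule trig_poly_minorant[OF h(1) \<delta>[OF j] K u(1)[OF j] u(2)[OF j]]) auto
  qed
  from bchoice[OF this] obtain Cm where Cm_all: "\<forall>j\<in>J. Cm j 0 = complex_of_real (\<delta> j - 2 * h) \<and>
      (\<forall>b. b \<noteq> 0 \<longrightarrow> norm (Cm j b) \<le> 1 / (h * of_int b ^ 2)) \<and>
      (\<forall>x. trig_poly K (Cm j) x \<in> \<real>) \<and> (\<forall>x. Re (trig_poly K (Cm j) x) \<le> indicator (I j) (frac x))"
    by (elim exE)
  have Cm0: "Cm j 0 = complex_of_real (\<delta> j - 2 * h)"
    and Cm: "\<And>b. b \<noteq> 0 \<Longrightarrow> norm (Cm j b) \<le> 1 / (h * of_int b ^ 2)"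
    and Cm_real: "\<And>x. trig_poly K (Cm j) x \<in> \<real>"
    and Cm_le: "\<And>x. Re (trig_poly K (Cm j) x) \<le> indicator (I j) (frac x)" if "j \<in> J" for j
    using bspec[OF Cm_all that] by simp_all
  \<comment> \<open>In the i-th family the factor at i is majorant minus minorant, of mean 4h, and
    all other factors remain majorants.\<close>
  define D where "D i j = (if j = i then \<lambda>b. Cp j b - Cm j b else Cp j)" for i j
  define Fp where "Fp j t = Re (trig_poly K (Cp j) (t * ?\<omega> j / (2 * pi)))" for j t
  define Fm where "Fm j t = Re (trig_poly K (Cm j) (t * ?\<omega> j / (2 * pi)))" for j t
  define x where "x j t = (indicator (I j) (frac (t * ?\<omega> j / (2 * pi))) :: real)" for j t
  define E where "E = 2 / \<kappa> * A ^ card J"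
  have \<delta>1: "\<delta> j \<le> 1" if "j \<in> J" for j using u[OF that] by simp
  have Ap: "(\<Sum>b\<in>{- int K..int K}. norm (Cp j b) * w b) \<le> A" if j: "j \<in> J" for j
  proof (rule A)
    show "norm (Cp j 0) \<le> 4" unfolding Cp0[OF j] norm_of_real using \<delta>1[OF j] \<delta>[OF j] h by simp
    fix b :: int assume b: "b \<noteq> 0"
    show "norm (Cp j b) \<le> 2 / (h * of_int b ^ 2)"
      by (rule order.trans[OF Cp[OF j b]]) (use h in \<open>auto intro!: divide_right_mono\<close>)
  qed
  have AD: "(\<Sum>b\<in>{- int K..int K}. norm (D i j b) * w b) \<le> A" if j: "j \<in> J" for i j
  proof (cases "j = i")
    case True
    show ?thesis
    proof (rule A)
      have "D i j 0 = of_real (4 * h)" using True Cp0[OF j] Cm0[OF j] by (simp add: D_def)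
      then show "norm (D i j 0) \<le> 4" using h by (simp only: norm_of_real)
      fix b :: int assume b: "b \<noteq> 0"
      have "norm (D i j b) \<le> norm (Cp j b) + norm (Cm j b)"
        using True by (simp add: D_def norm_triangle_ineq4)
      also have "\<dots> \<le> 1 / (h * of_int b ^ 2) + 1 / (h * of_int b ^ 2)"
        by (intro add_mono Cp Cm j b)
      finally show "norm (D i j b) \<le> 2 / (h * of_int b ^ 2)" by simp
    qed
  qed (use Ap[OF j] in \<open>simp add: D_def\<close>)
  have P: "(\<lambda>t. \<Prod>j\<in>J. Fp j t) integrable_on {T..2 * T}"
    "\<bar>integral {T..2 * T} (\<lambda>t. \<Prod>j\<in>J. Fp j t) - T * (\<Prod>j\<in>J. \<delta> j + 2 * h)\<bar> \<le> E"
    using integral_prod_trig_poly[where T = T and T' = "2 * T" and C = Cp and A = "\<lambda>_. A",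
        OF finJ _ \<kappa> w lower Cp0 Ap Cp_real] T
    by (simp_all add: Fp_def E_def)
  have x01: "0 \<le> x j t" "x j t \<le> Fp j t" "Fm j t \<le> x j t" if "j \<in> J" for j t
    using Cp_ge[OF that] Cm_le[OF that] by (simp_all add: x_def Fp_def Fm_def)
  have Fp0: "0 \<le> Fp j t" if "j \<in> J" for j t
    using x01(1,2)[OF that, of t] by simp
  have D: "(\<lambda>t. (Fp i t - Fm i t) * (\<Prod>j\<in>J - {i}. Fp j t)) integrable_on {T..2 * T}"
    "\<bar>integral {T..2 * T} (\<lambda>t. (Fp i t - Fm i t) * (\<Prod>j\<in>J - {i}. Fp j t))
      - T * (4 * h * (\<Prod>j\<in>J - {i}. \<delta> j + 2 * h))\<bar> \<le> E" if i: "i \<in> J" for i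
  proof -
    have D0: "D i j 0 = of_real (if j = i then 4 * h else \<delta> j + 2 * h)" if "j \<in> J" for j
      using Cp0[OF that] Cm0[OF that] by (cases "j = i") (auto simp: D_def)
    have D_real: "trig_poly K (D i j) x \<in> \<real>" if "j \<in> J" for j x
      using Cp_real[OF that] Cm_real[OF that] by (cases "j = i") (auto simp: D_def trig_poly_diff)
    have "(\<Prod>j\<in>J. Re (trig_poly K (D i j) (t * ?\<omega> j / (2 * pi)))) = (Fp i t - Fm i t) * (\<Prod>j\<in>J - {i}. Fp j t)" for t
    proof -
      have "(\<Prod>j\<in>J - {i}. Re (trig_poly K (D i j) (t * ?\<omega> j / (2 * pi)))) = (\<Prod>j\<in>J - {i}. Fp j t)"
        by (intro prod.cong) (auto simp: D_def Fp_def)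
      then show ?thesis
        using prod.remove[OF finJ i, of "\<lambda>j. Re (trig_poly K (D i j) (t * ?\<omega> j / (2 * pi)))"]
        by (simp add: D_def Fp_def Fm_def trig_poly_diff)
    qed
    moreover have "(\<Prod>j\<in>J. if j = i then 4 * h else \<delta> j + 2 * h) = 4 * h * (\<Prod>j\<in>J - {i}. \<delta> j + 2 * h)"
    proof -
      have "(\<Prod>j\<in>J - {i}. if j = i then 4 * h else \<delta> j + 2 * h) = (\<Prod>j\<in>J - {i}. \<delta> j + 2 * h)"
        by (intro prod.cong) auto
      then show ?thesis
        using prod.remove[OF finJ i, of "\<lambda>j. if j = i then 4 * h else \<delta> j + 2 * h"] by simp
    qed
    ultimately show "(\<lambda>t. (Fp i t - Fm i t) * (\<Prod>j\<in>J - {i}. Fp j t)) integrable_on {T..2 * T}"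
      "\<bar>integral {T..2 * T} (\<lambda>t. (Fp i t - Fm i t) * (\<Prod>j\<in>J - {i}. Fp j t))
        - T * (4 * h * (\<Prod>j\<in>J - {i}. \<delta> j + 2 * h))\<bar> \<le> E"
      using integral_prod_trig_poly[where T = T and T' = "2 * T" and C = "D i" and A = "\<lambda>_. A",
          OF finJ _ \<kappa> w lower D0 AD D_real] T
      by (simp_all add: E_def)
  qed
  have M: "(\<lambda>t. \<Prod>j\<in>J. x j t) integrable_on {T..2 * T}"
    "Kronecker_measure T y I = integral {T..2 * T} (\<lambda>t. \<Prod>j\<in>J. x j t)"
    using Kronecker_measure_integral[of y I T] I by (simp_all add: J_def x_def)
  have "Kronecker_measure T y I \<le> integral {T..2 * T} (\<lambda>t. \<Prod>j\<in>J. Fp j t)"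
    unfolding M(2) using x01 by (intro integral_le M P prod_mono) auto
  then show "Kronecker_measure T y I \<le> T * (\<Prod>j\<in>J. \<delta> j + 2 * h) + 2 / \<kappa> * A ^ card J"
    using P(2) by (simp add: E_def)
  define S where "S t = (\<Sum>i\<in>J. (Fp i t - Fm i t) * (\<Prod>j\<in>J - {i}. Fp j t))" for t
  have Sint: "S integrable_on {T..2 * T}"
    unfolding S_def[abs_def] using finJ D(1) by (intro integrable_sum) auto
  have "integral {T..2 * T} (\<lambda>t. \<Prod>j\<in>J. Fp j t) \<le> integral {T..2 * T} (\<lambda>t. (\<Prod>j\<in>J. x j t) + S t)"
  proof (rule integral_le[OF P(1) integrable_add[OF M(1) Sint]])
    fix t
    have "(\<Prod>j\<in>J. Fp j t) - (\<Prod>j\<in>J. x j t) \<le> (\<Sum>i\<in>J. (Fp i t - x i t) * (\<Prod>j\<in>J - {i}. Fp j t))"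
      using x01 by (intro prod_diff_le_sum finJ)
    also have "\<dots> \<le> S t"
      unfolding S_def using x01 Fp0
      by (intro sum_mono mult_right_mono prod_nonneg) auto
    finally show "(\<Prod>j\<in>J. Fp j t) \<le> (\<Prod>j\<in>J. x j t) + S t" by simp
  qed
  also have "\<dots> = Kronecker_measure T y I + integral {T..2 * T} S"
    unfolding M(2) by (rule integral_add[OF M(1) Sint])
  also have "integral {T..2 * T} S = (\<Sum>i\<in>J. integral {T..2 * T} (\<lambda>t. (Fp i t - Fm i t) * (\<Prod>j\<in>J - {i}. Fp j t)))"
    unfolding S_def[abs_def] using finJ D(1) by (intro integral_sum) auto
  also have "\<dots> \<le> (\<Sum>i\<in>J. T * (4 * h * (\<Prod>j\<in>J - {i}. \<delta> j + 2 * h)) + E)"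
  proof (rule sum_mono)
    fix i assume "i \<in> J"
    from D(2)[OF this] show "integral {T..2 * T} (\<lambda>t. (Fp i t - Fm i t) * (\<Prod>j\<in>J - {i}. Fp j t))
        \<le> T * (4 * h * (\<Prod>j\<in>J - {i}. \<delta> j + 2 * h)) + E"
      by linarith
  qed
  also have "\<dots> = (\<Sum>i\<in>J. T * (4 * h * (\<Prod>j\<in>J - {i}. \<delta> j + 2 * h))) + real (card J) * E"
    by (simp add: sum.distrib)
  finally show "Kronecker_measure T y I \<ge> T * (\<Prod>j\<in>J. \<delta> j + 2 * h)
        - (\<Sum>i\<in>J. T * (4 * h * (\<Prod>j\<in>J - {i}. \<delta> j + 2 * h))) - (1 + real (card J)) * (2 / \<kappa> * A ^ card J)"
    using P(2) unfolding E_def[symmetric] distrib_right abs_le_iff by simp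
qed

text \<open>After division by the main term the majorants contribute \<open>\<rho>\<close>, a
  product of 1 + 2h / \<delta> j and so at most exp (2 n s) with n = card J. Since h <= s (\<delta>
  i + 2h), restoring the missing factor bounds each correction by 4 s times the full product; thus
  the lower bound is \<open>\<rho>\<close> (1 - 4 n s) minus the error, and \<open>small\<close>
  makes the bracket nonnegative so that \<open>\<rho>\<close> may be replaced by 1.\<close>

lemma ratio_bound:
  fixes \<delta> :: "'a \<Rightarrow> real"
  assumes J: "finite J" and \<delta>: "\<And>j. j \<in> J \<Longrightarrow> \<delta> j > 0" and h: "h > 0" "\<And>j. j \<in> J \<Longrightarrow> h / \<delta> j \<le> s"
    and T: "T > 0"
    and upper: "M \<le> T * (\<Prod>j\<in>J. \<delta> j + 2 * h) + E"
    and lower: "M \<ge> T * (\<Prod>j\<in>J. \<delta> j + 2 * h)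
        - (\<Sum>i\<in>J. T * (4 * h * (\<Prod>j\<in>J - {i}. \<delta> j + 2 * h))) - (1 + real (card J)) * E"
    and E: "0 \<le> E" "E / (T * (\<Prod>j\<in>J. \<delta> j)) \<le> r" and small: "4 * real (card J) * s \<le> 1"
  shows "\<bar>M / (T * (\<Prod>j\<in>J. \<delta> j)) - 1\<bar> \<le> (exp (2 * real (card J) * s) - 1) + 4 * real (card J) * s + (1 + real (card J)) * r"
proof -
  define Q where "Q = T * (\<Prod>j\<in>J. \<delta> j)"
  define \<rho> where "\<rho> = (\<Prod>j\<in>J. 1 + 2 * h / \<delta> j)"
  define n where "n = real (card J)"
  have Q: "Q > 0" unfolding Q_def using T \<delta> by (intro mult_pos_pos prod_pos) auto
  \<comment> \<open>The sign of \<open>s\<close> follows from h / \<delta> j <= s at some j; for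
    empty \<open>J\<close> no such j exists, but then n = 0.\<close>
  have ns: "0 \<le> n * s"
  proof (cases "J = {}")
    case False
    then obtain j where "j \<in> J" by blast
    then have "0 \<le> s" using h(1) h(2)[of j] \<delta>[of j] by (intro order.trans[OF _ h(2)[of j]]) auto
    then show ?thesis by (simp add: n_def)
  qed (simp add: n_def)
  have main: "T * (\<Prod>j\<in>J. \<delta> j + 2 * h) = Q * \<rho>"
  proof -
    have "(\<Prod>j\<in>J. \<delta> j + 2 * h) = (\<Prod>j\<in>J. \<delta> j * (1 + 2 * h / \<delta> j))"
      using \<delta> by (intro prod.cong refl) (simp add: field_simps less_imp_neq[symmetric])
    then show ?thesis by (simp add: Q_def \<rho>_def prod.distrib)
  qed
  have \<rho>1: "1 \<le> \<rho>" unfolding \<rho>_def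
    using \<delta> h by (intro prod_ge_1) (auto intro!: divide_nonneg_pos)
  have "\<rho> \<le> (\<Prod>j\<in>J. exp (2 * s))"
    unfolding \<rho>_def
  proof (rule prod_mono, safe)
    fix j assume j: "j \<in> J"
    show "0 \<le> 1 + 2 * h / \<delta> j" using \<delta>[OF j] h by simp
    have "1 + 2 * h / \<delta> j \<le> 1 + 2 * s" using h(2)[OF j] by simp
    also have "\<dots> \<le> exp (2 * s)" by (rule exp_ge_add_one_self)
    finally show "1 + 2 * h / \<delta> j \<le> exp (2 * s)" .
  qed
  also have "\<dots> = exp (2 * n * s)" by (simp add: exp_of_nat_mult[symmetric] n_def mult_ac)
  finally have \<rho>_le: "\<rho> \<le> exp (2 * n * s)" .
  have D: "T * (4 * h * (\<Prod>j\<in>J - {i}. \<delta> j + 2 * h)) \<le> 4 * s * (Q * \<rho>)" if i: "i \<in> J" for i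
  proof -
    have pos: "0 \<le> \<delta> j + 2 * h" if "j \<in> J" for j
      using \<delta>[OF that] h(1) by simp
    have R: "0 \<le> (\<Prod>j\<in>J - {i}. \<delta> j + 2 * h)"
      using pos by (intro prod_nonneg) auto
    have "0 \<le> h / \<delta> i" using h(1) \<delta>[OF i] by simp
    then have s: "0 \<le> s" using h(2)[OF i] by simp
    have "h \<le> s * \<delta> i" using h(2)[OF i] \<delta>[OF i] by (simp add: field_simps)
    also have "\<dots> \<le> s * (\<delta> i + 2 * h)"
      using s h(1) \<delta>[OF i] by (intro mult_left_mono) auto
    finally have "T * (4 * h * (\<Prod>j\<in>J - {i}. \<delta> j + 2 * h)) \<le> T * (4 * (s * (\<delta> i + 2 * h)) * (\<Prod>j\<in>J - {i}. \<delta> j + 2 * h))"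
      using T R by (intro mult_left_mono mult_right_mono) auto
    also have "\<dots> = 4 * s * (T * ((\<delta> i + 2 * h) * (\<Prod>j\<in>J - {i}. \<delta> j + 2 * h)))"
      by (simp add: mult_ac)
    also have "(\<delta> i + 2 * h) * (\<Prod>j\<in>J - {i}. \<delta> j + 2 * h) = (\<Prod>j\<in>J. \<delta> j + 2 * h)"
      by (rule prod.remove[OF J i, symmetric])
    finally show ?thesis by (simp add: main)
  qed
  have "(\<Sum>i\<in>J. T * (4 * h * (\<Prod>j\<in>J - {i}. \<delta> j + 2 * h))) \<le> (\<Sum>i\<in>J. 4 * s * (Q * \<rho>))"
    by (rule sum_mono[OF D])
  also have "\<dots> = 4 * n * s * (Q * \<rho>)" by (simp add: n_def)
  finally have "M \<ge> Q * \<rho> * (1 - 4 * n * s) - (1 + n) * E"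
    using lower unfolding main n_def[symmetric] by (simp add: algebra_simps)
  moreover have "Q * 1 * (1 - 4 * n * s) \<le> Q * \<rho> * (1 - 4 * n * s)"
    using Q \<rho>1 small by (intro mult_right_mono mult_left_mono) (auto simp: n_def)
  ultimately have "M \<ge> Q * (1 - 4 * n * s) - (1 + n) * E" by simp
  then have "M / Q \<ge> (Q * (1 - 4 * n * s) - (1 + n) * E) / Q"
    using Q by (intro divide_right_mono) auto
  then have lo: "M / Q \<ge> 1 - 4 * n * s - (1 + n) * (E / Q)"
    using Q by (simp add: diff_divide_distrib)
  have "M / Q \<le> (Q * \<rho> + E) / Q"
    using upper Q unfolding main by (intro divide_right_mono) auto
  then have hi: "M / Q \<le> \<rho> + E / Q" using Q by (simp add: add_divide_distrib)
  have EQ: "0 \<le> E / Q" "E / Q \<le> r" using E Q by (auto simp: Q_def)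
  have "(1 + n) * (E / Q) \<le> (1 + n) * r" using EQ by (intro mult_left_mono) (auto simp: n_def)
  moreover have "1 * (E / Q) \<le> (1 + n) * (E / Q)" using EQ by (intro mult_right_mono) (auto simp: n_def)
  moreover have "1 \<le> exp (2 * n * s)" "0 \<le> 4 * n * s" using ns by simp_all
  ultimately have "\<bar>M / Q - 1\<bar> \<le> (exp (2 * n * s) - 1) + 4 * n * s + (1 + n) * r"
    using lo hi \<rho>_le unfolding abs_le_iff by (intro conjI; linarith)
  then show ?thesis by (simp add: Q_def n_def)
qed

text \<open>Per prime the exponents of L are 1/10 for 1 / c, 3 for the coefficient sum and 3/2 for 1
  / \<delta>, in total 46/10. In the exponential this is at most 4.6 * 0.15 L = 0.69 L; the
  primorial adds at most 1.04 * 0.14 L = 0.1456 L, and division by T subtracts L, leaving less than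
  -0.16 L.\<close>

lemma relative_error_le:
  assumes L: "1 < L" and c: "0 < c" "1 / c \<le> L powr (1/10)" and N: "real N * ln L \<le> 15/100 * L"
    and y: "0 \<le> y" "y \<le> L / 10"
  shows "2 / (c ^ N / (4 powr y) powr (26/25)) * (L ^ 3) ^ N / (exp L * (L powr (- 3/2)) ^ N)
    \<le> 2 * exp (- (16/100) * L)"
proof -
  define Z where "Z = L powr (- 3/2)"
  have Z: "Z > 0" using L by (simp add: Z_def)
  have eq1: "2 / (c ^ N / X) * (L ^ 3) ^ N / (exp L * Z ^ N) = 2 * (1 / c * L ^ 3 / Z) ^ N * X * exp (- L)" for X
    using c(1) Z by (simp add: exp_minus divide_inverse power_mult_distrib power_inverse mult_ac)
  have "L ^ 3 = L powr 3" using L by (simp add: powr_numeral)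
  then have "L powr (1/10) * L ^ 3 / Z = L powr (46/10)"
    by (simp only: Z_def powr_add[symmetric] powr_diff[symmetric]) simp
  moreover have "1 / c * L ^ 3 / Z \<le> L powr (1/10) * L ^ 3 / Z"
    using L Z by (intro divide_right_mono mult_right_mono c(2)) simp_all
  ultimately have "(1 / c * L ^ 3 / Z) ^ N \<le> (L powr (46/10)) ^ N"
    using c(1) L Z by (intro power_mono) simp_all
  moreover have "(L powr (46/10)) ^ N = exp (46/10 * (real N * ln L))"
    using L by (simp add: powr_def exp_of_nat_mult[symmetric] mult_ac)
  ultimately have "2 * (1 / c * L ^ 3 / Z) ^ N * (4 powr y) powr (26/25) * exp (- L)
      \<le> 2 * exp (46/10 * (real N * ln L)) * (4 powr y) powr (26/25) * exp (- L)"
    by (intro mult_right_mono mult_left_mono) simp_all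
  also have "\<dots> = 2 * exp (46/10 * (real N * ln L) + 26/25 * (y * ln 4) + - L)"
    unfolding exp_add by (simp add: powr_def mult_ac)
  also have "\<dots> \<le> 2 * exp (- (16/100) * L)"
  proof -
    have "y * ln 4 \<le> L / 10 * (14/10)"
      using y L ln_4_less by (intro mult_mono) auto
    then show ?thesis using N L by simp
  qed
  finally show ?thesis unfolding Z_def[symmetric] eq1 .
qed

lemma eventually_at_top_ln: "eventually P at_top \<Longrightarrow> eventually (\<lambda>T::real. P (ln T :: real)) at_top"
  by (rule eventually_compose_filterlim[OF _ ln_at_top])

theorem mainTheorem5:
  assumes "Lang_Waldschmidt_conjecture"
  shows "\<forall>\<eta>::real. \<eta> > 0 \<longrightarrow>
    (\<forall>\<^sub>F T::real in at_top. \<forall>(y::real) (I::nat \<Rightarrow> real set) (\<delta>::nat \<Rightarrow> real).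
       2 < y \<longrightarrow> y \<le> ln T / 10 \<longrightarrow>
       (\<forall>j\<in>{1..prime_count y}. \<delta> j > 0 \<and> open_interval_of_length (\<delta> j) (I j) \<and>
          I j \<subseteq> {0<..<1} \<and> \<delta> j > ln T powr (- 3 / 2)) \<longrightarrow>
       \<bar>Kronecker_measure T y I / (T * (\<Prod>j=1..prime_count y. \<delta> j)) - 1\<bar> < \<eta>)"
proof (intro allI impI)
  fix \<eta> :: real assume \<eta>: "\<eta> > 0"
  obtain c where c: "c > 0" and LW: "\<And>y (\<beta> :: nat \<Rightarrow> int). \<lbrakk>0 \<le> y; \<exists>j\<in>{1..prime_count y}. \<beta> j \<noteq> 0\<rbrakk> \<Longrightarrow>
      c ^ prime_count y / (4 powr y) powr (1 + 1/25) / (\<Prod>j\<in>{1..prime_count y}. of_int (max \<bar>\<beta> j\<bar> 1) powr (1 + 1/25))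
        \<le> \<bar>\<Sum>j\<in>{1..prime_count y}. of_int (\<beta> j) * ln (real (nth_prime j))\<bar>"
    using Lang_Waldschmidt_primes[OF assms, of "1/25"] by auto
  \<comment> \<open>The exponent is 5/2 from 1 / h plus 5/25 from K^\<epsilon>, that is 27/10, so
    L^3 also covers the logarithm; the summand 4 bounds the zeroth coefficient.\<close>
  have 1: "\<forall>\<^sub>F L::real in at_top. 4 + 4 * L powr (5/2) * ((2 * L ^ 5) powr (1/25) * (1 + ln (2 * L ^ 5))) \<le> L ^ 3"
    by real_asymp
  \<comment> \<open>Nothing is known about the size of \<open>c\<close>, so it is absorbed by a
    small power of L for each prime.\<close>
  have 2: "\<forall>\<^sub>F L::real in at_top. 1 / c \<le> L powr (1/10)"
    by real_asymp
  \<comment> \<open>This is the bound of \<open>ratio_bound\<close> at s = 1/L, with N / L replaced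
    by 0.15 / ln L and, in the last term, N by L.\<close>
  have "((\<lambda>L::real. (exp (2 * (15/100 / ln L)) - 1) + 4 * (15/100 / ln L) + (1 + L) * (2 * exp (- (16/100) * L))) \<longlongrightarrow> 0) at_top"
    by real_asymp
  then have 3: "\<forall>\<^sub>F L::real in at_top. (exp (2 * (15/100 / ln L)) - 1) + 4 * (15/100 / ln L) + (1 + L) * (2 * exp (- (16/100) * L)) < \<eta>"
    using \<eta> by (rule order_tendstoD)
  have 4: "\<forall>\<^sub>F L::real in at_top. 1 \<le> ln L" by real_asymp
  have "\<forall>\<^sub>F T::real in at_top. 0 < T" by (rule eventually_gt_at_top)
  then show "\<forall>\<^sub>F T::real in at_top. \<forall>(y::real) (I::nat \<Rightarrow> real set) (\<delta>::nat \<Rightarrow> real).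
       2 < y \<longrightarrow> y \<le> ln T / 10 \<longrightarrow>
       (\<forall>j\<in>{1..prime_count y}. \<delta> j > 0 \<and> open_interval_of_length (\<delta> j) (I j) \<and>
          I j \<subseteq> {0<..<1} \<and> \<delta> j > ln T powr (- 3 / 2)) \<longrightarrow>
       \<bar>Kronecker_measure T y I / (T * (\<Prod>j=1..prime_count y. \<delta> j)) - 1\<bar> < \<eta>"
    using eventually_at_top_ln[OF eventually_prime_count_bound] eventually_at_top_ln[OF 1]
      eventually_at_top_ln[OF 2] eventually_at_top_ln[OF 3] eventually_at_top_ln[OF 4]
      eventually_at_top_ln[OF eventually_gt_at_top[of 1]]
  proof eventually_elim
    case (elim T)
    define L where "L = ln T"
    have L1: "L > 1" and lnL: "ln L \<ge> 1" using elim by (simp_all add: L_def)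
    show ?case
    proof (intro allI impI)
      fix y :: real and I \<delta>
      assume y: "2 < y" "y \<le> ln T / 10" and *: "\<forall>j\<in>{1..prime_count y}. \<delta> j > 0 \<and> open_interval_of_length (\<delta> j) (I j) \<and>
          I j \<subseteq> {0<..<1} \<and> \<delta> j > ln T powr (- 3 / 2)"
      define N where "N = prime_count y"
      define h where "h = L powr (- 5/2)"
      define K where "K = nat \<lceil>L ^ 5\<rceil>"
      define \<kappa> where "\<kappa> = c ^ N / (4 powr y) powr (26/25)"
      define w where "w b = real_of_int (max \<bar>b\<bar> 1) powr (26/25)" for b :: int
      define E where "E = 2 / \<kappa> * (L ^ 3) ^ card {1..N}"
      have "\<forall>j\<in>{1..N}. \<exists>u. I j = {u<..<u + \<delta> j}"
        using * by (auto simp: N_def open_interval_of_length_def)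
      from bchoice[OF this] obtain u where u: "\<And>j. j \<in> {1..N} \<Longrightarrow> I j = {u j<..<u j + \<delta> j}" by blast
      have \<delta>: "0 < \<delta> j" "L powr (- 3/2) < \<delta> j" if "j \<in> {1..N}" for j
        using * that by (auto simp: N_def L_def)
      have u01: "0 \<le> u j" "u j + \<delta> j \<le> 1" if j: "j \<in> {1..N}" for j
      proof -
        have "I j \<subseteq> {0<..<1}" using bspec[OF *, of j] j by (simp add: N_def)
        then have "{u j<..<u j + \<delta> j} \<subseteq> {0<..<1}" by (simp only: u[OF j])
        then show "0 \<le> u j" "u j + \<delta> j \<le> 1"
          using \<delta>(1)[OF j] by (auto simp: greaterThanLessThan_subseteq_greaterThanLessThan)
      qed
      have h: "0 < h" "h < 1" using L1 by (auto simp: h_def powr_less_one)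
      have h_less: "h < \<delta> j" if "j \<in> {1..N}" for j
      proof -
        have "h \<le> L powr (- 3/2)" unfolding h_def using L1 by (intro powr_mono) auto
        then show ?thesis using \<delta>(2)[OF that] by simp
      qed
      have h_ratio: "h / \<delta> j \<le> 1 / L" if "j \<in> {1..N}" for j
      proof -
        have "h / \<delta> j \<le> h / L powr (- 3/2)"
          using \<delta>[OF that] h L1 by (intro divide_left_mono mult_pos_pos) auto
        also have "\<dots> = 1 / L"
          unfolding h_def powr_diff[symmetric] using L1 by (simp add: powr_minus_divide)
        finally show ?thesis .
      qed
      have K_ge: "L ^ 5 \<le> real K" unfolding K_def by linarith
      have K_le: "real K \<le> 2 * L ^ 5"
      proof -
        have "1 \<le> L ^ 5" using L1 by (intro one_le_power) auto
        then show ?thesis unfolding K_def by linarith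
      qed
      have K0: "0 < K" using K_ge L1 by (intro Nat.gr0I) (auto simp: not_le)
      have "h\<^sup>2 = L powr (- 5)"
        unfolding h_def power2_eq_square powr_add[symmetric] by simp
      then have hK: "1 / h\<^sup>2 \<le> real K"
        using K_ge L1 by (simp add: powr_minus_divide powr_numeral)
      have ih: "4 / h = 4 * L powr (5/2)"
        by (simp add: h_def powr_minus_divide)
      have A: "(\<Sum>b\<in>{- int K..int K}. norm (C b) * w b) \<le> L ^ 3"
        if "norm (C 0) \<le> 4" "\<And>b. b \<noteq> 0 \<Longrightarrow> norm (C b) \<le> 2 / (h * of_int b ^ 2)" for C :: "int \<Rightarrow> complex"
      proof -
        have "(\<Sum>b\<in>{- int K..int K}. norm (C b) * w b) \<le> 4 + 4 / h * (real K powr (1/25) * (1 + ln (real K)))"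
          using weighted_coefficient_sum_le[OF h(1) _ K0 that, of "1/25"] by (simp add: w_def)
        also have "\<dots> \<le> 4 + 4 / h * ((2 * L ^ 5) powr (1/25) * (1 + ln (2 * L ^ 5)))"
          using h K_le K0 L1 by (intro add_left_mono mult_left_mono mult_mono powr_mono2) auto
        also have "\<dots> \<le> L ^ 3" using elim unfolding ih L_def by simp
        finally show ?thesis .
      qed
      have \<kappa>: "\<kappa> > 0" using c by (simp add: \<kappa>_def)
      have w: "w b > 0" for b by (simp add: w_def)
      have lower: "\<kappa> / (\<Prod>j\<in>{1..N}. w (\<beta> j)) \<le> \<bar>\<Sum>j\<in>{1..N}. of_int (\<beta> j) * ln (real (nth_prime j))\<bar>"
        if "\<exists>j\<in>{1..N}. \<beta> j \<noteq> 0" for \<beta>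
        using LW[of y \<beta>] y that by (simp add: \<kappa>_def w_def N_def)
      have NL: "real N * ln L \<le> 15/100 * L"
        using elim y by (simp add: N_def L_def)
      then have NL': "real N / L \<le> 15/100 / ln L"
        using L1 lnL by (simp add: field_simps)
      have "real N * 1 \<le> real N * ln L" using lnL by (intro mult_left_mono) auto
      with NL have N_le: "real N \<le> L" using L1 by linarith
      have "15/100 / ln L \<le> 15/100" using lnL by (simp add: field_simps)
      with NL' have small: "4 * real (card {1..N}) * (1 / L) \<le> 1" by simp
      have T: "T = exp L" using elim by (simp add: L_def)
      \<comment> \<open>The error does not depend on the \<delta> j, so its relative size is worst
        when each of them is at its lower limit L^(-3/2).\<close>
      have "E / (T * (\<Prod>j\<in>{1..N}. \<delta> j)) \<le> E / (T * (L powr (- 3/2)) ^ N)"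
      proof (rule divide_left_mono)
        have "(\<Prod>j\<in>{1..N}. L powr (- 3/2)) \<le> (\<Prod>j\<in>{1..N}. \<delta> j)"
          using \<delta>(2) by (intro prod_mono) (auto intro: less_imp_le)
        then show "T * (L powr (- 3/2)) ^ N \<le> T * (\<Prod>j\<in>{1..N}. \<delta> j)" using elim by simp
        show "0 \<le> E" using \<kappa> L1 by (simp add: E_def)
        show "0 < T * (\<Prod>j\<in>{1..N}. \<delta> j) * (T * (L powr (- 3/2)) ^ N)"
          using elim \<delta>(1) L1 by (intro mult_pos_pos prod_pos) auto
      qed
      also have "\<dots> \<le> 2 * exp (- (16/100) * L)"
        using relative_error_le[of L c N y] L1 c NL y elim
        by (simp add: E_def \<kappa>_def T L_def[symmetric])
      finally have E_le: "E / (T * (\<Prod>j\<in>{1..N}. \<delta> j)) \<le> 2 * exp (- (16/100) * L)" .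
      note bounds = Kronecker_measure_bounds[of T \<kappa> w y h K I u \<delta> "L ^ 3", folded N_def,
          OF _ \<kappa> w lower h hK u u01 h_less A]
      have "\<bar>Kronecker_measure T y I / (T * (\<Prod>j\<in>{1..N}. \<delta> j)) - 1\<bar>
        \<le> (exp (2 * real (card {1..N}) * (1 / L)) - 1) + 4 * real (card {1..N}) * (1 / L)
          + (1 + real (card {1..N})) * (2 * exp (- (16/100) * L))"
      proof (rule ratio_bound[OF _ \<delta>(1) h(1) h_ratio _ _ _ _ E_le small])
        show "Kronecker_measure T y I \<le> T * (\<Prod>j\<in>{1..N}. \<delta> j + 2 * h) + E"
          unfolding E_def using elim by (intro bounds(1)) auto
        show "Kronecker_measure T y I \<ge> T * (\<Prod>j\<in>{1..N}. \<delta> j + 2 * h)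
          - (\<Sum>i\<in>{1..N}. T * (4 * h * (\<Prod>j\<in>{1..N} - {i}. \<delta> j + 2 * h))) - (1 + real (card {1..N})) * E"
          unfolding E_def using elim by (intro bounds(2)) auto
        show "0 \<le> E" using \<kappa> L1 by (simp add: E_def)
      qed (use elim in auto)
      also have "\<dots> = (exp (2 * (real N / L)) - 1) + 4 * (real N / L) + (1 + real N) * (2 * exp (- (16/100) * L))"
        by simp
      also have "\<dots> \<le> (exp (2 * (15/100 / ln L)) - 1) + 4 * (15/100 / ln L) + (1 + L) * (2 * exp (- (16/100) * L))"
      proof -
        have "exp (2 * (real N / L)) \<le> exp (2 * (15/100 / ln L))" using NL' by simp
        moreover have "(1 + real N) * (2 * exp (- (16/100) * L)) \<le> (1 + L) * (2 * exp (- (16/100) * L))"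
          using N_le by (intro mult_right_mono) auto
        ultimately show ?thesis using NL' by linarith
      qed
      also have "\<dots> < \<eta>" using elim by (simp add: L_def)
      finally show "\<bar>Kronecker_measure T y I / (T * (\<Prod>j=1..prime_count y. \<delta> j)) - 1\<bar> < \<eta>"
        by (simp add: N_def)
    qed
  qed
qed

end
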